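(* Let $H$ be an infinite-dimensional Hilbert space over $\mathbb{F}\in\{\mathbb{R},\mathbb{C}\}$, let $B(H)$ be the Banach space of bounded linear operators on $H$ with the operator norm, and let $T\in B(H)$ with $\|T\|=1$. Put $M_T=\{x\in H:\|x\|=1,\ \|Tx\|=\|T\|\}$. Then the following are equivalent. (i) The norm of $B(H)$ is strongly subdifferentiable at $T$. (ii) $M_T\neq\emptyset$, and for every maximizing sequence $\{x_n\}$ of $T$ there exists a subsequence $\{x_{n_i}\}$ of $\{x_n\}$ such that $d(x_{n_i},M_T)\to 0$. (iii) $T$ attains its norm and $\|P_T|_{M_T^\perp}\|<1$, where $P_T=(T^*T)^{1/2}$.
   Context: For a Banach space $X$, $S_X$ and $B_X$ denote its unit sphere and closed unit ball. The norm of $X$ is strongly subdifferentiable at $u\in X$ if $\lim_{t\to0^+}\frac{\|u+tx\|-\|u\|}{t}=\max\{\operatorname{Re}f(x): f\in J_{X^*}(u)\}$ uniformly for $x\in B_X$, where $J_{X^*}(u)=\{f\in S_{X^*}: f(u)=\|u\|\}$. A bounded operator $T:X\to Y$ between Banach spaces attains its norm if $\|Tx\|=\|T\|$ for some $x\in S_X$. A maximizing sequence for $T\in B(X,Y)$ is a sequence $\{x_n\}$ with $x_n\in S_X$ for all $n$ and $\|Tx_n\|\to\|T\|$. $d(x,M)$ denotes the norm distance from the point $x$ to the set $M$. $M_T^\perp$ denotes the orthogonal complement in $H$ of the set $M_T$, and $P_T|_{M_T^\perp}$ is the restriction of $P_T$ to it. *)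

theory Defs
  imports "HOL-Analysis.Analysis"
begin

section \<open>Scalars\<close>

text \<open>
  The scalar field is \<open>\<real>\<close> or \<open>\<complex>\<close>. Both are handled at once by a class with a conjugation and
  a real part; lemma \<open>real_or_complex_cases\<close> shows that the class has no other members.
\<close>

class real_or_complex = real_normed_field +
  fixes scnj :: "'a \<Rightarrow> 'a"
    and sRe :: "'a \<Rightarrow> real"
  assumes scnj_add: "scnj (x + y) = scnj x + scnj y"
    and scnj_mult: "scnj (x * y) = scnj x * scnj y"
    and mult_scnj_scaleR: "x * scnj x = (norm x * norm x) *\<^sub>R 1"
    and add_scnj_scaleR: "x + scnj x = (2 * sRe x) *\<^sub>R 1"

lemma mult_scnj: "x * scnj x = (of_real ((norm x)\<^sup>2) :: 'k::real_or_complex)"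
  by (simp add: mult_scnj_scaleR of_real_def power2_eq_square)

lemma add_scnj: "x + scnj x = (of_real (2 * sRe x) :: 'k::real_or_complex)"
  by (simp add: add_scnj_scaleR of_real_def)

instantiation real :: real_or_complex
begin

definition scnj_real :: "real \<Rightarrow> real" where "scnj_real x = x"
definition sRe_real :: "real \<Rightarrow> real" where "sRe_real x = x"

instance
  by standard (auto simp: scnj_real_def sRe_real_def power2_eq_square)

end

instantiation complex :: real_or_complex
begin

definition scnj_complex :: "complex \<Rightarrow> complex" where "scnj_complex = cnj"
definition sRe_complex :: "complex \<Rightarrow> real" where "sRe_complex = Re"

instance
  by standard (auto simp: scnj_complex_def sRe_complex_def complex_add_cnj scaleR_conv_of_real
      complex_norm_square[symmetric] power2_eq_square[symmetric] simp flip: of_real_power)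

end

lemma scnj_of_real [simp]: "scnj (of_real r :: 'k::real_or_complex) = of_real r"
proof (cases "r = 0")
  case True
  then show ?thesis using scnj_add[of "0::'k" 0] by simp
next
  case False
  have "of_real r * scnj (of_real r :: 'k) = of_real r * of_real r"
    using mult_scnj[of "of_real r :: 'k"] by (simp add: power2_eq_square)
  with False show ?thesis by simp
qed

lemma scnj_zero [simp]: "scnj (0 :: 'k::real_or_complex) = 0"
  using scnj_of_real[of 0, where 'k='k] by simp

lemma scnj_minus: "scnj (- x :: 'k::real_or_complex) = - scnj x"
  using scnj_add[of x "- x"] by (simp add: eq_neg_iff_add_eq_0 add.commute)

lemma sRe_of_real [simp]: "sRe (of_real r :: 'k::real_or_complex) = r"
proof -
  have "of_real (2 * sRe (of_real r :: 'k)) = (of_real (2 * r) :: 'k)"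
    using add_scnj[of "of_real r :: 'k"] by simp
  then have "2 * sRe (of_real r :: 'k) = 2 * r" by (simp only: of_real_eq_iff)
  then show ?thesis by simp
qed

lemma sRe_add: "sRe (x + y :: 'k::real_or_complex) = sRe x + sRe y"
proof -
  have "of_real (2 * sRe (x + y)) = (x + scnj x) + (y + scnj y)"
    by (simp only: add_scnj[symmetric] scnj_add) (simp add: algebra_simps)
  also have "\<dots> = (of_real (2 * sRe x + 2 * sRe y) :: 'k)"
    by (simp only: add_scnj of_real_add)
  finally have "2 * sRe (x + y) = 2 * sRe x + 2 * sRe y" by (simp only: of_real_eq_iff)
  then show ?thesis by simp
qed

lemma scnj_eq_self: "scnj x = x \<Longrightarrow> x = (of_real (sRe x) :: 'k::real_or_complex)"
  using add_scnj[of x] by simp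

lemma scnj_eq: "scnj x = of_real (2 * sRe x) - (x :: 'k::real_or_complex)"
  by (simp only: add_scnj[symmetric]) simp

lemma real_or_complex_cases:
  "bij (of_real :: real \<Rightarrow> 'k::real_or_complex) \<or>
   (\<exists>h :: complex \<Rightarrow> 'k. bij h \<and> (\<forall>a b. h (a + b) = h a + h b) \<and> (\<forall>a b. h (a * b) = h a * h b)
      \<and> (\<forall>r. h (of_real r) = of_real r) \<and> (\<forall>a. norm (h a) = norm a)
      \<and> (\<forall>a. scnj (h a) = h (cnj a)) \<and> (\<forall>a. sRe (h a) = Re a))"
proof (cases "\<forall>z::'k. \<exists>r. z = of_real r")
  case True
  then show ?thesis by (auto simp: bij_def inj_def surj_def)
next
  case False
  then obtain z :: 'k where z: "\<And>r. z \<noteq> of_real r" by auto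
  define skew where "skew v = v - of_real (sRe v)" for v :: 'k
  have skew: "scnj (skew v) = - skew v" for v
    using scnj_add[of v "- of_real (sRe v)"] scnj_eq[of v]
    by (simp add: skew_def scnj_minus)
  define w where "w = skew z"
  have w0: "w \<noteq> 0" using z[of "sRe z"] by (simp add: w_def skew_def)
  define i where "i = w / of_real (norm w)"
  have "w * w = - of_real ((norm w)\<^sup>2)"
    using mult_scnj[of w] skew[of z] by (metis w_def minus_minus mult_minus_right)
  then have ii: "i * i = -1"
    using w0 by (simp add: i_def field_simps power2_eq_square)
  then have i0: "i \<noteq> 0" by auto
  have iw: "w = of_real (norm w) * i" using w0 by (simp add: i_def)
  have "scnj w = of_real (norm w) * scnj i"
    by (subst iw) (simp only: scnj_mult scnj_of_real)
  then have ci: "scnj i = - i"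
    using skew[of z] w0 by (simp add: w_def[symmetric] i_def field_simps)
  define h where "h a = (of_real (Re a) + of_real (Im a) * i :: 'k)" for a
  have h_add: "h (a + b) = h a + h b" for a b by (simp add: h_def algebra_simps)
  have h_mult: "h (a * b) = h a * h b" for a b
  proof -
    have "h a * h b = of_real (Re a) * of_real (Re b) + of_real (Im a) * of_real (Im b) * (i * i)
        + (of_real (Re a) * of_real (Im b) + of_real (Im a) * of_real (Re b)) * i"
      by (simp add: h_def algebra_simps)
    then show ?thesis unfolding ii by (simp add: h_def algebra_simps)
  qed
  have h_real: "h (of_real r) = of_real r" for r by (simp add: h_def)
  have h_cnj: "scnj (h a) = h (cnj a)" for a
    by (simp add: h_def scnj_add scnj_mult ci)
  have h_norm: "norm (h a) = norm a" for a
  proof -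
    have "of_real ((norm (h a))\<^sup>2) = h (a * cnj a)"
      by (simp only: mult_scnj[symmetric] h_cnj h_mult)
    also have "\<dots> = of_real ((norm a)\<^sup>2)"
      by (simp only: complex_norm_square[symmetric] h_real)
    finally have "(norm (h a))\<^sup>2 = (norm a)\<^sup>2" by (simp only: of_real_eq_iff)
    then show ?thesis by simp
  qed
  have h_Re: "sRe (h a) = Re a" for a
  proof -
    have "(of_real (2 * sRe (h a)) :: 'k) = h (a + cnj a)"
      by (simp only: add_scnj[symmetric] h_cnj h_add)
    also have "\<dots> = of_real (2 * Re a)" by (simp only: complex_add_cnj h_real)
    finally have "2 * sRe (h a) = 2 * Re a" by (simp only: of_real_eq_iff)
    then show ?thesis by simp
  qed
  have "inj h"
  proof (rule injI)
    fix a b assume "h a = h b"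
    then have "h (a - b) = 0" using h_add[of "a - b" b] by simp
    then show "a = b" using h_norm[of "a - b"] by simp
  qed
  moreover have "\<exists>a. v = h a" for v
  proof -
    have "scnj (skew v * i) = skew v * i" by (simp add: scnj_mult skew ci)
    then have "skew v * i = of_real (sRe (skew v * i))" by (rule scnj_eq_self)
    then have "skew v * (i * i) = of_real (sRe (skew v * i)) * i" by (simp add: mult.assoc[symmetric])
    then have "v = of_real (sRe v) + of_real (- sRe (skew v * i)) * i"
      by (simp add: ii skew_def algebra_simps)
    then have "v = h (Complex (sRe v) (- sRe (skew v * i)))" by (simp add: h_def)
    then show ?thesis by blast
  qed
  ultimately have "bij h" by (auto simp: bij_def surj_def)
  with h_add h_mult h_real h_norm h_cnj h_Re show ?thesis by blast
qed


section \<open>Hilbert spaces\<close>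

text \<open>
  The sort \<open>{real_inner, banach}\<close> supplies the underlying real Hilbert space; the inner product
  \<open>ip\<close> is linear in its first argument.
\<close>

locale hilbert_space = vector_space smul
  for smul :: "'k::real_or_complex \<Rightarrow> 'h::{real_inner, banach} \<Rightarrow> 'h" +
  fixes ip :: "'h \<Rightarrow> 'h \<Rightarrow> 'k"
  assumes smul_of_real: "smul (of_real r) x = r *\<^sub>R x"
    and ip_add_left: "ip (x + y) z = ip x z + ip y z"
    and ip_smul_left: "ip (smul c x) y = c * ip x y"
    and ip_commute: "ip y x = scnj (ip x y)"
    and ip_self: "ip x x = of_real ((norm x)\<^sup>2)"
begin

lemma ip_add_right: "ip x (y + z) = ip x y + ip x z"
  by (metis ip_add_left ip_commute scnj_add)

lemma ip_smul_right: "ip x (smul c y) = scnj c * ip x y"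
  by (metis ip_smul_left ip_commute scnj_mult)

lemma sRe_ip: "sRe (ip x y) = x \<bullet> y"
proof -
  have "of_real ((norm (x + y))\<^sup>2) = ip x x + ip y y + (ip x y + ip y x)"
    by (simp only: ip_self[symmetric] ip_add_left ip_add_right) (simp add: algebra_simps)
  also have "\<dots> = of_real ((norm x)\<^sup>2 + (norm y)\<^sup>2 + 2 * sRe (ip x y))"
    by (simp only: ip_self ip_commute[of y x] add_scnj of_real_add)
  finally have "(norm (x + y))\<^sup>2 = (norm x)\<^sup>2 + (norm y)\<^sup>2 + 2 * sRe (ip x y)"
    by (simp only: of_real_eq_iff)
  then show ?thesis
    by (simp add: power2_norm_eq_inner inner_add_left inner_add_right inner_commute)
qed

lemma norm_smul: "norm (smul c x) = norm c * norm x"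
proof -
  have "of_real ((norm (smul c x))\<^sup>2) = (c * scnj c) * ip x x"
    by (simp only: ip_self[symmetric] ip_smul_left ip_smul_right) (simp add: mult.assoc)
  also have "\<dots> = of_real ((norm c * norm x)\<^sup>2)"
    by (simp only: mult_scnj ip_self of_real_mult power_mult_distrib)
  finally have "(norm (smul c x))\<^sup>2 = (norm c * norm x)\<^sup>2" by (simp only: of_real_eq_iff)
  then show ?thesis by (simp add: power2_eq_iff_nonneg)
qed

end

lemma hilbert_space_real:
  "hilbert_space (scaleR :: real \<Rightarrow> 'h::{real_inner, banach} \<Rightarrow> 'h) inner"
  by unfold_locales
    (auto simp: scnj_real_def inner_commute inner_add_left power2_norm_eq_inner algebra_simps)

lemma hilbert_space_complex: "hilbert_space (*) (\<lambda>x y. x * cnj y)"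
  by unfold_locales
    (auto simp: scnj_complex_def complex_norm_square[symmetric] scaleR_conv_of_real algebra_simps)

definition infinite_dimensional :: "('k::field \<Rightarrow> 'h::ab_group_add \<Rightarrow> 'h) \<Rightarrow> bool" where
  "infinite_dimensional smul \<longleftrightarrow> (\<nexists>B. finite B \<and> module.span smul B = UNIV)"

definition orth_complement :: "('h \<Rightarrow> 'h \<Rightarrow> 'k::zero) \<Rightarrow> 'h set \<Rightarrow> 'h set" where
  "orth_complement ip M = {x. \<forall>y\<in>M. ip x y = 0}"


section \<open>The Banach space of bounded operators\<close>

text \<open>
  \<open>B(H)\<close> is the set of those bounded real-linear maps (type \<open>blinfun\<close>, normed by the operator
  norm) that are linear over the scalar field; over \<open>\<real>\<close> it is everything.
\<close>

definition bounded_ops ::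
    "('k \<Rightarrow> 'h \<Rightarrow> 'h::real_normed_vector) \<Rightarrow> ('h \<Rightarrow>\<^sub>L 'h) set" where
  "bounded_ops smul = {T. \<forall>c x. blinfun_apply T (smul c x) = smul c (blinfun_apply T x)}"

definition op_smul ::
    "('k \<Rightarrow> 'h \<Rightarrow> 'h::real_normed_vector) \<Rightarrow> 'k \<Rightarrow> ('h \<Rightarrow>\<^sub>L 'h) \<Rightarrow> ('h \<Rightarrow>\<^sub>L 'h)" where
  "op_smul smul c T = Blinfun (\<lambda>x. smul c (blinfun_apply T x))"

context hilbert_space
begin

lemma smul_scaleR: "smul c (r *\<^sub>R x) = r *\<^sub>R smul c x"
  by (simp add: smul_of_real[symmetric] mult.commute)

lemma op_smul_apply [simp]: "blinfun_apply (op_smul smul c T) x = smul c (blinfun_apply T x)"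
proof -
  have "bounded_linear (smul c)"
    by (rule bounded_linear_intro[where K = "norm c"])
      (simp_all add: scale_right_distrib smul_scaleR norm_smul mult.commute)
  then have "bounded_linear (\<lambda>x. smul c (blinfun_apply T x))"
    using blinfun.bounded_linear_right by (rule bounded_linear_compose)
  then show ?thesis by (simp add: op_smul_def bounded_linear_Blinfun_apply)
qed

lemma bounded_ops_closed:
  "0 \<in> bounded_ops smul"
  "S \<in> bounded_ops smul \<Longrightarrow> T \<in> bounded_ops smul \<Longrightarrow> S + T \<in> bounded_ops smul"
  "T \<in> bounded_ops smul \<Longrightarrow> op_smul smul c T \<in> bounded_ops smul"
  by (auto simp: bounded_ops_def blinfun.add_left scale_right_distrib mult.commute)

lemma norm_op_smul: "norm (op_smul smul c T) = norm c * norm T"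
proof -
  have "onorm (\<lambda>x. blinfun_apply (op_smul smul c T) x) = onorm (\<lambda>x. norm c *\<^sub>R blinfun_apply T x)"
    by (simp add: onorm_def norm_smul)
  also have "\<dots> = \<bar>norm c\<bar> * onorm (blinfun_apply T)"
    by (rule onorm_scaleR[OF blinfun.bounded_linear_right])
  finally show ?thesis by (simp add: norm_blinfun.rep_eq del: op_smul_apply)
qed

end

definition norming_set :: "('h::real_normed_vector \<Rightarrow>\<^sub>L 'g::real_normed_vector) \<Rightarrow> 'h set" where
  "norming_set T = {x. norm x = 1 \<and> norm (blinfun_apply T x) = norm T}"

definition attains_norm :: "('h::real_normed_vector \<Rightarrow>\<^sub>L 'g::real_normed_vector) \<Rightarrow> bool" where
  "attains_norm T \<longleftrightarrow> (\<exists>x. norm x = 1 \<and> norm (blinfun_apply T x) = norm T)"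

definition maximizing_sequence ::
    "('h::real_normed_vector \<Rightarrow>\<^sub>L 'g::real_normed_vector) \<Rightarrow> (nat \<Rightarrow> 'h) \<Rightarrow> bool" where
  "maximizing_sequence T x \<longleftrightarrow>
     (\<forall>n. norm (x n) = 1) \<and> (\<lambda>n. norm (blinfun_apply T (x n))) \<longlonglongrightarrow> norm T"

definition hilbert_adjoint ::
    "('k \<Rightarrow> 'h \<Rightarrow> 'h::real_normed_vector) \<Rightarrow> ('h \<Rightarrow> 'h \<Rightarrow> 'k) \<Rightarrow> ('h \<Rightarrow>\<^sub>L 'h) \<Rightarrow> ('h \<Rightarrow>\<^sub>L 'h)" where
  "hilbert_adjoint smul ip T =
     (THE S. S \<in> bounded_ops smul \<and>
        (\<forall>x y. ip (blinfun_apply T x) y = ip x (blinfun_apply S y)))"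

text \<open>Self-adjointness has to be demanded explicitly: over \<open>\<real>\<close> it does not follow from the
  quadratic form being nonnegative.\<close>

definition positive_op ::
    "('k::real_or_complex \<Rightarrow> 'h \<Rightarrow> 'h::real_normed_vector) \<Rightarrow> ('h \<Rightarrow> 'h \<Rightarrow> 'k) \<Rightarrow> ('h \<Rightarrow>\<^sub>L 'h) \<Rightarrow> bool" where
  "positive_op smul ip P \<longleftrightarrow> P \<in> bounded_ops smul \<and>
     (\<forall>x y. ip (blinfun_apply P x) y = ip x (blinfun_apply P y)) \<and>
     (\<forall>x. 0 \<le> sRe (ip (blinfun_apply P x) x))"

definition op_sqrt ::
    "('k::real_or_complex \<Rightarrow> 'h \<Rightarrow> 'h::real_normed_vector) \<Rightarrow> ('h \<Rightarrow> 'h \<Rightarrow> 'k) \<Rightarrow> ('h \<Rightarrow>\<^sub>L 'h) \<Rightarrow> ('h \<Rightarrow>\<^sub>L 'h)" where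
  "op_sqrt smul ip A = (THE P. positive_op smul ip P \<and> P o\<^sub>L P = A)"

definition abs_op ::
    "('k::real_or_complex \<Rightarrow> 'h \<Rightarrow> 'h::real_normed_vector) \<Rightarrow> ('h \<Rightarrow> 'h \<Rightarrow> 'k) \<Rightarrow> ('h \<Rightarrow>\<^sub>L 'h) \<Rightarrow> ('h \<Rightarrow>\<^sub>L 'h)" where
  "abs_op smul ip T = op_sqrt smul ip (hilbert_adjoint smul ip T o\<^sub>L T)"

definition restricted_norm ::
    "('h::real_normed_vector \<Rightarrow>\<^sub>L 'g::real_normed_vector) \<Rightarrow> 'h set \<Rightarrow> real" where
  "restricted_norm T M = (SUP x\<in>{x\<in>M. norm x \<le> 1}. norm (blinfun_apply T x))"


section \<open>Strong subdifferentiability\<close>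

text \<open>
  In this section the Banach space is a subset \<open>X\<close> of a normed space type, with scalar
  multiplication \<open>smul\<close>; a functional on \<open>X\<close> is represented by any function agreeing with it on \<open>X\<close>.
\<close>

definition dual_on ::
    "('k::real_or_complex \<Rightarrow> 'x \<Rightarrow> 'x::real_normed_vector) \<Rightarrow> 'x set \<Rightarrow> ('x \<Rightarrow> 'k) set" where
  "dual_on smul X = {f. (\<forall>x\<in>X. \<forall>y\<in>X. f (x + y) = f x + f y) \<and>
     (\<forall>c. \<forall>x\<in>X. f (smul c x) = c * f x) \<and> (\<exists>K. \<forall>x\<in>X. norm (f x) \<le> K * norm x)}"

definition dual_norm_on :: "'x::real_normed_vector set \<Rightarrow> ('x \<Rightarrow> 'k::real_normed_vector) \<Rightarrow> real" where
  "dual_norm_on X f = (SUP x\<in>{x\<in>X. norm x \<le> 1}. norm (f x))"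

definition duality_set ::
    "('k::real_or_complex \<Rightarrow> 'x \<Rightarrow> 'x::real_normed_vector) \<Rightarrow> 'x set \<Rightarrow> 'x \<Rightarrow> ('x \<Rightarrow> 'k) set" where
  "duality_set smul X u = {f \<in> dual_on smul X. dual_norm_on X f = 1 \<and> f u = of_real (norm u)}"

definition is_max :: "real set \<Rightarrow> real \<Rightarrow> bool" where
  "is_max A m \<longleftrightarrow> m \<in> A \<and> (\<forall>a\<in>A. a \<le> m)"

definition strongly_subdifferentiable ::
    "('k::real_or_complex \<Rightarrow> 'x \<Rightarrow> 'x::real_normed_vector) \<Rightarrow> 'x set \<Rightarrow> 'x \<Rightarrow> bool" where
  "strongly_subdifferentiable smul X u \<longleftrightarrow>
     (\<exists>m. (\<forall>x\<in>X \<inter> cball 0 1. is_max ((\<lambda>f. sRe (f x)) ` duality_set smul X u) (m x)) \<and>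
          uniform_limit (X \<inter> cball 0 1) (\<lambda>t x. (norm (u + t *\<^sub>R x) - norm u) / t) m (at_right 0))"

end

theory Submission
  imports Defs
begin

text \<open>
  Write \<open>A = T\<^sup>* T\<close> and let \<open>N = {x. norm (T x) = norm x}\<close>. Since \<open>norm T = 1\<close>, the operator
  \<open>1 - A\<close> is positive and \<open>N\<close> is its kernel, a closed subspace that reduces \<open>A\<close>; the set \<open>M\<^sub>T\<close> is
  the unit sphere of \<open>N\<close>, and \<open>M\<^sub>T\<close> and \<open>N\<close> have the same orthogonal complement. As
  \<open>norm (P\<^sub>T x) = norm (T x)\<close>, each of the three conditions is equivalent to: \<open>N\<close> is nonzero and
  \<open>norm (T z) \<le> \<rho> * norm z\<close> on the orthogonal complement of \<open>N\<close> for some \<open>\<rho> < 1\<close>. In spectral terms,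
  1 is an isolated point of the spectrum of \<open>A\<close>; the spectral theorem is avoided throughout.

  Maximizing sequences. Splitting a unit vector as \<open>x = p + q\<close> along \<open>N\<close> gives
  \<open>(norm (T x))\<^sup>2 = (norm p)\<^sup>2 + (norm (T q))\<^sup>2\<close>. With a gap, \<open>norm (T x)\<close> near 1 therefore forces \<open>q\<close>
  to be small, so \<open>x\<close> is near \<open>M\<^sub>T\<close>. Without a gap there is a maximizing sequence orthogonal to \<open>N\<close>,
  and its members stay at distance at least 1 from \<open>M\<^sub>T\<close>.

  From the gap to strong subdifferentiability. For \<open>x \<in> M\<^sub>T\<close>, testing \<open>T + t S\<close> on \<open>x\<close> shows that
  \<open>m S = (SUP x\<in>M\<^sub>T. T x \<bullet> S x)\<close> is at most the difference quotient in the direction \<open>S\<close>. In the other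
  direction \<open>norm ((T + t S) x)\<^sup>2 \<le> 1 - \<delta> (norm q)\<^sup>2 + 2 t (m S + 4 norm q) + t\<^sup>2\<close>, and completing the
  square in \<open>norm q\<close> bounds the quotient by \<open>m S + C t\<close> with \<open>C\<close> depending on the gap alone
  (lemma \<open>norm_perturbation_le\<close>). That \<open>m S\<close> is a maximum over the duality set needs a functional
  when the supremum is not attained on \<open>M\<^sub>T\<close>: take a pointwise cluster point of the functionals
  \<open>R \<mapsto> \<langle>R x\<^sub>n, T x\<^sub>n\<rangle>\<close> along a sequence approaching the supremum, which exists by Tychonoff's theorem
  (lemma \<open>duality_set_limit\<close>).

  From strong subdifferentiability to the gap. For a unit vector \<open>z = (1 - A) w\<close> take the rank-one
  direction \<open>S x = \<langle>x, z\<rangle> T z\<close>. Where \<open>T\<close> almost attains its norm, \<open>(1 - A) x\<close> is almost zero, hence so is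
  \<open>\<langle>x, z\<rangle> = \<langle>(1 - A) x, w\<rangle>\<close>, and the directional derivative at \<open>T\<close> is at most 0
  (lemma \<open>norm_rank_one_perturbation_le\<close>). But \<open>(T + t S) z = (1 + t) T z\<close>, so uniformity at a single
  \<open>t\<close> bounds \<open>norm (T z)\<close> away from 1, with the same bound for all such \<open>z\<close>. These \<open>z\<close> span a dense
  subspace of the orthogonal complement of \<open>N\<close>.
\<close>


section \<open>Representation of functionals and orthogonal projection\<close>

text \<open>Minimality along every line through a minimizer kills the first-order term.\<close>
lemma linear_coeff_zero:
  fixes c d :: real
  assumes "\<And>t. 0 \<le> 2 * t * c + t\<^sup>2 * d" "0 \<le> d"
  shows "c = 0"
proof -
  define s where "s = - c / (d + 1)"
  have c: "c = - s * (d + 1)" using assms(2) by (simp add: s_def field_simps)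
  have "0 \<le> 2 * s * c + s\<^sup>2 * d" by (rule assms)
  also have "\<dots> = - (s\<^sup>2 * (d + 2))" by (simp add: c power2_eq_square algebra_simps)
  finally have "s = 0" using assms(2) by (simp add: mult_le_0_iff)
  then show ?thesis by (simp add: c)
qed

text \<open>
  The representing vector minimizes \<open>(norm y)\<^sup>2 - 2 f y\<close> over the subspace; the parallelogram law
  makes minimizing sequences Cauchy. Functionals \<open>inner x\<close> yield orthogonal projections, and the
  whole space as subspace yields adjoints.
\<close>
lemma riesz_on_closed_subspace:
  fixes f :: "'h::{real_inner, banach} \<Rightarrow> real"
  assumes f: "bounded_linear f" and V: "closed V" "subspace V"
  shows "\<exists>p\<in>V. \<forall>z\<in>V. f z = p \<bullet> z"
proof -
  interpret bounded_linear f by (rule f)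
  define J where "J y = (norm y)\<^sup>2 - 2 * f y" for y
  obtain K where K: "\<And>x. norm (f x) \<le> norm x * K" using bounded by blast
  have J_lower: "- K\<^sup>2 \<le> J y" for y
  proof -
    have "f y \<le> norm y * K" using K[of y] by simp
    moreover have "0 \<le> (norm y - K)\<^sup>2" by simp
    ultimately show ?thesis unfolding J_def power2_diff by linarith
  qed
  define I where "I = Inf (J ` V)"
  have bdd: "bdd_below (J ` V)" using J_lower by (auto intro!: bdd_belowI[of _ "- K\<^sup>2"])
  have ne: "V \<noteq> {}" using V(2) subspace_0 by blast
  have I_le: "I \<le> J y" if "y \<in> V" for y
    unfolding I_def using bdd that by (auto intro: cInf_lower)
  have "\<exists>y\<in>V. J y < I + 1 / real (Suc n)" for n
    using cInf_lessD[of "J ` V" "I + 1 / real (Suc n)"] ne by (auto simp: I_def)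
  then obtain y where y: "\<And>n. y n \<in> V" "\<And>n. J (y n) < I + 1 / real (Suc n)" by metis
  have para: "(norm (a - b))\<^sup>2 = 2 * (J a + J b - 2 * J ((1/2) *\<^sub>R (a + b)))" for a b
    by (simp add: J_def power2_norm_eq_inner inner_add_left inner_add_right
        inner_diff_left inner_diff_right inner_commute add scaleR algebra_simps)
  have near: "(norm (a - b))\<^sup>2 \<le> 2 * (J a + J b - 2 * I)" if "a \<in> V" "b \<in> V" for a b
  proof -
    have "(1/2) *\<^sub>R (a + b) \<in> V" using V(2) that by (simp add: subspace_add subspace_scale)
    then show ?thesis using I_le[of "(1/2) *\<^sub>R (a + b)"] unfolding para[of a b] by simp
  qed
  have "Cauchy y"
  proof (rule metric_CauchyI)
    fix e :: real assume e: "0 < e"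
    then obtain M where M: "1 / real (Suc M) < e\<^sup>2 / 4"
      using nat_approx_posE[of "e\<^sup>2 / 4"] by (auto simp: field_simps)
    have "dist (y m) (y n) < e" if "m \<ge> M" "n \<ge> M" for m n
    proof -
      have J_near: "J (y k) < I + e\<^sup>2 / 4" if "k \<ge> M" for k
      proof -
        have "1 / real (Suc k) \<le> 1 / real (Suc M)" using that by (simp add: frac_le)
        then show ?thesis using y(2)[of k] M by (meson add_left_mono le_less_trans less_imp_le less_le_trans)
      qed
      have "(norm (y m - y n))\<^sup>2 \<le> 2 * (J (y m) + J (y n) - 2 * I)" by (rule near) (rule y)+
      also have "\<dots> < e\<^sup>2"
        using J_near[OF that(1)] J_near[OF that(2)] by simp
      finally show ?thesis using e by (simp add: dist_norm power2_less_imp_less)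
    qed
    then show "\<exists>M. \<forall>m\<ge>M. \<forall>n\<ge>M. dist (y m) (y n) < e" by blast
  qed
  then obtain p where p: "y \<longlonglongrightarrow> p" using convergent_eq_Cauchy by blast
  have pV: "p \<in> V" using closed_sequentially[OF V(1)] y(1) p by blast
  have "(\<lambda>n. J (y n)) \<longlonglongrightarrow> J p" unfolding J_def by (intro tendsto_intros tendsto p)
  moreover have "(\<lambda>n. I + 1 / real (Suc n)) \<longlonglongrightarrow> I + 0"
    by (intro tendsto_intros LIMSEQ_Suc[OF lim_1_over_n])
  ultimately have "J p \<le> I"
    using LIMSEQ_le[of "\<lambda>n. J (y n)" "J p" "\<lambda>n. I + 1 / real (Suc n)" I] y(2)
    by (auto intro: less_imp_le)
  have "f z = p \<bullet> z" if z: "z \<in> V" for z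
  proof -
    have "0 \<le> 2 * t * (p \<bullet> z - f z) + t\<^sup>2 * (norm z)\<^sup>2" for t
    proof -
      have "J p \<le> J (p + t *\<^sub>R z)"
        using \<open>J p \<le> I\<close> I_le[of "p + t *\<^sub>R z"] V(2) pV z by (simp add: subspace_add subspace_scale)
      also have "J (p + t *\<^sub>R z) = J p + 2 * t * (p \<bullet> z - f z) + t\<^sup>2 * (norm z)\<^sup>2"
        unfolding J_def power2_norm_eq_inner
        by (simp add: inner_add_left inner_add_right inner_commute
            add scaleR algebra_simps power2_eq_square)
      finally show ?thesis by simp
    qed
    then have "p \<bullet> z - f z = 0" by (rule linear_coeff_zero) simp
    then show ?thesis by simp
  qed
  with pV show ?thesis by blast
qed

lemma orthogonal_decomposition:
  fixes x :: "'h::{real_inner, banach}"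
  assumes "closed V" "subspace V"
  obtains p q where "p \<in> V" "\<And>v. v \<in> V \<Longrightarrow> q \<bullet> v = 0" "x = p + q"
proof -
  obtain p where p: "p \<in> V" "\<forall>z\<in>V. x \<bullet> z = p \<bullet> z"
    using riesz_on_closed_subspace[OF bounded_linear_inner_right assms] by blast
  show ?thesis
    by (rule that[of p "x - p"]) (use p in \<open>auto simp: inner_diff_left\<close>)
qed

lemma inner_adjoint_exists:
  fixes T :: "'h::{real_inner, banach} \<Rightarrow>\<^sub>L 'h"
  shows "\<exists>S :: 'h \<Rightarrow>\<^sub>L 'h. \<forall>x y. T x \<bullet> y = x \<bullet> S y"
proof -
  have "\<exists>s. \<forall>x. T x \<bullet> y = x \<bullet> s" for y
  proof -
    have "bounded_linear (\<lambda>x. T x \<bullet> y)"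
      by (rule bounded_linear_compose[OF bounded_linear_inner_left blinfun.bounded_linear_right])
    from riesz_on_closed_subspace[OF this closed_UNIV] show ?thesis
      by (auto simp: inner_commute)
  qed
  then obtain s where s: "\<And>x y. T x \<bullet> y = x \<bullet> s y" by metis
  have "bounded_linear s"
  proof (rule bounded_linear_intro[where K = "norm T"])
    show "s (x + y) = s x + s y" for x y
      by (rule vector_eq_ldot[THEN iffD1]) (simp add: s[symmetric] inner_add_right)
    show "s (r *\<^sub>R x) = r *\<^sub>R s x" for r x
      by (rule vector_eq_ldot[THEN iffD1]) (simp add: s[symmetric])
    show "norm (s x) \<le> norm x * norm T" for x
    proof -
      have "norm (s x) * norm (s x) = T (s x) \<bullet> x"
        by (simp add: s power2_norm_eq_inner flip: power2_eq_square)
      also have "\<dots> \<le> norm (T (s x)) * norm x" by (rule norm_cauchy_schwarz)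
      also have "\<dots> \<le> norm T * norm (s x) * norm x"
        by (intro mult_right_mono norm_blinfun) simp
      finally show ?thesis by (cases "s x = 0") (auto simp: mult.commute mult.left_commute)
    qed
  qed
  then have "\<forall>x y. T x \<bullet> y = x \<bullet> Blinfun s y" by (simp add: bounded_linear_Blinfun_apply s)
  then show ?thesis by blast
qed


section \<open>Positive operators and their square roots\<close>

text \<open>
  Positivity for the underlying real inner product; \<open>positive_op_iff\<close> below compares it with
  positivity over the scalar field.
\<close>
definition positive_symmetric :: "('h::real_inner \<Rightarrow>\<^sub>L 'h) \<Rightarrow> bool" where
  "positive_symmetric A \<longleftrightarrow> (\<forall>x y. A x \<bullet> y = x \<bullet> A y) \<and> (\<forall>x. 0 \<le> A x \<bullet> x)"

lemma positive_symmetricD: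
  assumes "positive_symmetric A"
  shows "A x \<bullet> y = x \<bullet> A y" "0 \<le> A x \<bullet> x"
  using assms unfolding positive_symmetric_def by blast+

text \<open>
  Positivity at \<open>x - t A x\<close> with \<open>t = 1 / norm A\<close>, the choice that makes the term quadratic in \<open>t\<close>
  cancel half of the linear one.
\<close>
lemma positive_symmetric_norm_le:
  assumes "positive_symmetric A"
  shows "(norm (A x))\<^sup>2 \<le> norm A * (A x \<bullet> x)"
proof (cases "A = 0")
  case False
  define t where "t = 1 / norm A"
  have sym: "A u \<bullet> v = u \<bullet> A v" for u v by (rule positive_symmetricD[OF assms])
  have "0 \<le> A (x - t *\<^sub>R A x) \<bullet> (x - t *\<^sub>R A x)"
    by (rule positive_symmetricD[OF assms])
  also have "\<dots> = A x \<bullet> x - t * (A x \<bullet> A x) - t * (A (A x) \<bullet> x) + t\<^sup>2 * (A (A x) \<bullet> A x)"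
    by (simp add: blinfun.bilinear_simps inner_diff_left inner_diff_right
        power2_eq_square algebra_simps)
  also have "\<dots> = A x \<bullet> x - 2 * t * (norm (A x))\<^sup>2 + t\<^sup>2 * (A (A x) \<bullet> A x)"
    by (simp add: sym[of "A x" x] power2_norm_eq_inner)
  also have "A (A x) \<bullet> A x \<le> norm A * (norm (A x))\<^sup>2"
    using norm_cauchy_schwarz[of "A (A x)" "A x"] norm_blinfun[of A "A x"]
      mult_right_mono[OF norm_blinfun[of A "A x"], of "norm (A x)"]
    by (simp add: power2_eq_square mult.assoc)
  finally have "0 \<le> A x \<bullet> x - 2 * t * (norm (A x))\<^sup>2 + t\<^sup>2 * (norm A * (norm (A x))\<^sup>2)"
    by (simp add: mult_left_mono)
  also have "t\<^sup>2 * (norm A * (norm (A x))\<^sup>2) = t * (norm (A x))\<^sup>2"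
    using False by (simp add: t_def power2_eq_square)
  finally have "(norm (A x))\<^sup>2 / norm A \<le> A x \<bullet> x" by (simp add: t_def)
  then show ?thesis using False by (simp add: pos_divide_le_eq mult.commute)
qed simp

text \<open>
  With \<open>A = 1 - B\<close> the square root is \<open>1 - Z\<close>, where \<open>Z = (B + Z\<^sup>2) / 2\<close> is obtained by iteration from
  0. The scalar iteration \<open>y \<mapsto> (1 + y\<^sup>2) / 2\<close> increases and is bounded by 1, and its increments
  dominate the norms of those of the operator iteration, which therefore converges in norm. Every
  iterate is a polynomial in \<open>B\<close>, so whatever commutes with \<open>A\<close> commutes with the root; this gives
  both uniqueness of the root and its linearity over the scalar field.
\<close>
lemma positive_square_root_exists:
  fixes A :: "'h::{real_inner, banach} \<Rightarrow>\<^sub>L 'h"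
  assumes A: "positive_symmetric A" "norm A \<le> 1"
  obtains P where "positive_symmetric P" "P o\<^sub>L P = A"
    "\<And>C. C o\<^sub>L A = A o\<^sub>L C \<Longrightarrow> C o\<^sub>L P = P o\<^sub>L C"
proof -
  define B where "B = id_blinfun - A"
  have symA: "A u \<bullet> v = u \<bullet> A v" for u v by (rule positive_symmetricD[OF A(1)])
  have normB: "norm B \<le> 1"
  proof (rule norm_blinfun_bound)
    fix x
    have pos: "0 \<le> A x \<bullet> x" by (rule positive_symmetricD[OF A(1)])
    have Bx: "(norm (B x))\<^sup>2 = (norm x)\<^sup>2 - 2 * (A x \<bullet> x) + (norm (A x))\<^sup>2"
      unfolding B_def blinfun.diff_left power2_norm_eq_inner inner_diff_left inner_diff_right
      by (simp add: inner_commute[of x "A x"])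
    have "norm A * (A x \<bullet> x) \<le> 1 * (A x \<bullet> x)" by (rule mult_right_mono[OF A(2) pos])
    from order_trans[OF positive_symmetric_norm_le[OF A(1), of x] this]
    have "(norm (A x))\<^sup>2 \<le> A x \<bullet> x" by simp
    then have "(norm (B x))\<^sup>2 \<le> (norm x)\<^sup>2" unfolding Bx using pos by simp
    then have "norm (B x) \<le> norm x" by (rule power2_le_imp_le) simp
    then show "norm (B x) \<le> 1 * norm x" by simp
  qed simp
  define Y where "Y n = ((\<lambda>Z. (1/2) *\<^sub>R (B + (Z o\<^sub>L Z))) ^^ n) 0" for n
  define y where "y n = ((\<lambda>z::real. (1 + z\<^sup>2) / 2) ^^ n) 0" for n
  have Y0: "Y 0 = 0" and YS: "Y (Suc n) = (1/2) *\<^sub>R (B + (Y n o\<^sub>L Y n))" for n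
    by (simp_all add: Y_def)
  have y0: "y 0 = 0" and yS: "y (Suc n) = (1 + (y n)\<^sup>2) / 2" for n by (simp_all add: y_def)
  have y_bounds: "0 \<le> y n \<and> y n \<le> 1" for n
    by (induction n) (auto simp: y0 yS power_le_one)
  have Y_le: "norm (Y n) \<le> y n" for n
  proof (induction n)
    case (Suc n)
    have "norm (Y n o\<^sub>L Y n) \<le> norm (Y n) * norm (Y n)" by (rule norm_blinfun_compose)
    also have "\<dots> \<le> (y n)\<^sup>2" using Suc by (simp add: power2_eq_square mult_mono')
    finally show ?case
      using norm_triangle_ineq[of B "Y n o\<^sub>L Y n"] normB by (simp add: YS yS)
  qed (simp add: Y0 y0)
  have step: "norm (Y (Suc n) - Y n) \<le> y (Suc n) - y n" for n
  proof (induction n)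
    case 0
    show ?case using normB by (simp add: YS yS Y0 y0)
  next
    case (Suc n)
    let ?D = "Y (Suc n) - Y n"
    \<comment> \<open>This splitting of a difference of squares is valid without commutativity.\<close>
    have "Y (Suc (Suc n)) - Y (Suc n) = (1/2) *\<^sub>R ((Y (Suc n) o\<^sub>L ?D) + (?D o\<^sub>L Y n))"
      by (subst YS, subst (3) YS, rule blinfun_eqI)
        (simp add: blinfun.bilinear_simps algebra_simps)
    then have "norm (Y (Suc (Suc n)) - Y (Suc n))
        \<le> (norm (Y (Suc n) o\<^sub>L ?D) + norm (?D o\<^sub>L Y n)) / 2"
      using norm_triangle_ineq[of "Y (Suc n) o\<^sub>L ?D" "?D o\<^sub>L Y n"] by simp
    also have "\<dots> \<le> (norm (Y (Suc n)) * norm ?D + norm ?D * norm (Y n)) / 2"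
      by (intro divide_right_mono add_mono norm_blinfun_compose) simp
    also have "\<dots> \<le> (y (Suc n) * (y (Suc n) - y n) + (y (Suc n) - y n) * y n) / 2"
      using Suc Y_le y_bounds order_trans[OF norm_ge_zero Suc]
      by (intro divide_right_mono add_mono mult_mono) auto
    also have "\<dots> = ((y (Suc n))\<^sup>2 - (y n)\<^sup>2) / 2" by (simp add: power2_eq_square algebra_simps)
    also have "\<dots> = y (Suc (Suc n)) - y (Suc n)" 
      using arg_cong2[OF yS[of "Suc n"] yS[of n], of "(-)"]
      by (simp add: add_divide_distrib diff_divide_distrib)
    finally show ?case .
  qed
  have incr: "y n \<le> y (Suc n)" for n using order_trans[OF norm_ge_zero step[of n]] by simp
  have "summable (\<lambda>n. y (Suc n) - y n)"
  proof (rule telescope_summable)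
    obtain l where "y \<longlonglongrightarrow> l"
      using incseq_convergent[of y 1] y_bounds incseq_SucI[of y] incr by blast
    then show "y \<longlonglongrightarrow> lim y" by (simp add: limI)
  qed
  then have "summable (\<lambda>n. Y (Suc n) - Y n)" by (rule summable_comparison_test'[where N=0]) (rule step)
  then have "(\<lambda>n. \<Sum>i<n. Y (Suc i) - Y i) \<longlonglongrightarrow> (\<Sum>i. Y (Suc i) - Y i)"
    by (rule summable_LIMSEQ)
  then obtain Z where Z: "Y \<longlonglongrightarrow> Z" by (simp add: sum_lessThan_telescope Y0)
  have comp_lim: "(\<lambda>n. U n o\<^sub>L V n) \<longlonglongrightarrow> (u o\<^sub>L v)" if "U \<longlonglongrightarrow> u" "V \<longlonglongrightarrow> v"
    for U V :: "nat \<Rightarrow> 'h \<Rightarrow>\<^sub>L 'h" and u v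
    by (rule bounded_bilinear.tendsto[OF bounded_bilinear_blinfun_compose that])
  have "(\<lambda>n. Y (Suc n)) \<longlonglongrightarrow> (1/2) *\<^sub>R (B + (Z o\<^sub>L Z))"
    unfolding YS by (intro tendsto_intros comp_lim Z)
  then have fix_point: "Z = (1/2) *\<^sub>R (B + (Z o\<^sub>L Z))"
    using LIMSEQ_unique LIMSEQ_Suc[OF Z] by blast
  have normZ: "norm Z \<le> 1"
    by (rule LIMSEQ_le_const2[OF tendsto_norm[OF Z]]) (use Y_le y_bounds order_trans in blast)
  have symY: "Y n u \<bullet> v = u \<bullet> Y n v" for n u v
    by (induction n arbitrary: u v)
      (simp_all add: Y0 YS B_def blinfun.bilinear_simps inner_add_left inner_add_right
        inner_diff_left inner_diff_right symA)
  have symZ: "Z u \<bullet> v = u \<bullet> Z v" for u v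
  proof (rule LIMSEQ_unique)
    show "(\<lambda>n. Y n u \<bullet> v) \<longlonglongrightarrow> Z u \<bullet> v" by (intro tendsto_intros Z)
    show "(\<lambda>n. Y n u \<bullet> v) \<longlonglongrightarrow> u \<bullet> Z v" unfolding symY by (intro tendsto_intros Z)
  qed
  show ?thesis
  proof (rule that[of "id_blinfun - Z"])
    have "0 \<le> (x - Z x) \<bullet> x" for x
    proof -
      have "Z x \<bullet> x \<le> norm (Z x) * norm x" by (rule norm_cauchy_schwarz)
      also have "\<dots> \<le> (norm x)\<^sup>2"
        using norm_blinfun[of Z x] mult_right_mono[OF normZ norm_ge_zero[of x]]
        by (auto simp: power2_eq_square intro!: mult_right_mono)
      finally show ?thesis by (simp add: inner_diff_left power2_norm_eq_inner)
    qed
    then show "positive_symmetric (id_blinfun - Z)"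
      by (auto simp: positive_symmetric_def blinfun.diff_left inner_diff_left inner_diff_right symZ)
    have "2 *\<^sub>R Z = B + (Z o\<^sub>L Z)" by (subst fix_point) simp
    then have Zx: "Z x + Z x = x - A x + Z (Z x)" for x
      by (metis B_def blinfun.add_left blinfun.diff_left blinfun_apply_blinfun_compose
          blinfun_apply_id_blinfun id_apply scaleR_2)
    show "(id_blinfun - Z) o\<^sub>L (id_blinfun - Z) = A"
      by (rule blinfun_eqI) (use Zx in \<open>simp add: blinfun.bilinear_simps algebra_simps\<close>)
    show "C o\<^sub>L (id_blinfun - Z) = (id_blinfun - Z) o\<^sub>L C" if C: "C o\<^sub>L A = A o\<^sub>L C" for C
    proof -
      have CA: "C (A x) = A (C x)" for x using C by (metis blinfun_apply_blinfun_compose)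
      have "C (Y n x) = Y n (C x)" for n x
        by (induction n arbitrary: x)
          (simp_all add: Y0 YS B_def blinfun.bilinear_simps CA)
      then have CY: "C o\<^sub>L Y n = Y n o\<^sub>L C" for n by (intro blinfun_eqI) simp
      have "(\<lambda>n. C o\<^sub>L Y n) \<longlonglongrightarrow> (C o\<^sub>L Z)" by (intro comp_lim tendsto_const Z)
      moreover have "(\<lambda>n. C o\<^sub>L Y n) \<longlonglongrightarrow> (Z o\<^sub>L C)"
        unfolding CY by (intro comp_lim tendsto_const Z)
      ultimately have "C o\<^sub>L Z = Z o\<^sub>L C" by (rule LIMSEQ_unique)
      then have "C (Z x) = Z (C x)" for x by (metis blinfun_apply_blinfun_compose)
      then show ?thesis by (intro blinfun_eqI) (simp add: blinfun.bilinear_simps)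
    qed
  qed
qed

text \<open>
  For \<open>y = (P - Q) x\<close> one has \<open>(P + Q) y = (P\<^sup>2 - Q\<^sup>2) x = 0\<close>; by positivity \<open>P y = Q y = 0\<close>, and then
  \<open>y \<bullet> y = (P - Q) y \<bullet> x = 0\<close>.
\<close>
lemma positive_square_root_unique:
  fixes P Q :: "'h::real_inner \<Rightarrow>\<^sub>L 'h"
  assumes P: "positive_symmetric P" and Q: "positive_symmetric Q"
    and sq: "P o\<^sub>L P = Q o\<^sub>L Q" and comm: "P o\<^sub>L Q = Q o\<^sub>L P"
  shows "P = Q"
proof (rule blinfun_eqI)
  fix x
  define y where "y = P x - Q x"
  have PP: "P (P u) = Q (Q u)" for u using sq by (metis blinfun_apply_blinfun_compose)
  have PQ: "P (Q u) = Q (P u)" for u using comm by (metis blinfun_apply_blinfun_compose)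
  have pos: "0 \<le> P y \<bullet> y" "0 \<le> Q y \<bullet> y"
    by (rule positive_symmetricD[OF P], rule positive_symmetricD[OF Q])
  have "P y + Q y = 0" by (simp add: y_def blinfun.diff_right PP PQ)
  then have "P y \<bullet> y + Q y \<bullet> y = 0" by (simp flip: inner_add_left)
  then have "P y \<bullet> y = 0" "Q y \<bullet> y = 0" using pos by linarith+
  then have "P y = 0" "Q y = 0"
    using positive_symmetric_norm_le[OF P, of y] positive_symmetric_norm_le[OF Q, of y] by auto
  then have "y \<bullet> y = 0"
    by (subst (2) y_def)
      (simp add: inner_diff_right flip: positive_symmetricD(1)[OF P] positive_symmetricD(1)[OF Q])
  then show "P x = Q x" by (simp add: y_def)
qed

section \<open>From real inner products to the scalar field\<close>

lemma sRe_mult_right_cancel: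
  fixes a b :: "'k::real_or_complex"
  assumes "\<And>c. sRe (c * a) = sRe (c * b)"
  shows "a = b"
proof -
  have "sRe (c * (a - b)) = 0" for c
    using sRe_add[of "c * (a - b)" "c * b"] assms[of c] by (simp add: algebra_simps)
  from this[of "scnj (a - b)"] have "sRe ((a - b) * scnj (a - b)) = 0"
    by (simp add: mult.commute)
  then show ?thesis unfolding mult_scnj sRe_of_real by simp
qed

lemma norm_scnj: "norm (scnj x) = norm (x :: 'k::real_or_complex)"
proof (cases "x = 0")
  case False
  have "norm x * norm (scnj x) = norm x * norm x"
    using arg_cong[OF mult_scnj[of x], of norm] by (simp add: norm_mult power2_eq_square)
  then show ?thesis using False by simp
qed simp

lemma abs_sRe_le_norm: "\<bar>sRe x\<bar> \<le> norm (x :: 'k::real_or_complex)"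
  using arg_cong[OF add_scnj[of x], of norm] norm_triangle_ineq[of x "scnj x"]
  by (simp add: norm_scnj abs_mult)

lemma sRe_diff: "sRe (x - y :: 'k::real_or_complex) = sRe x - sRe y"
  using sRe_add[of "x - y" y] by simp

lemma scnj_scnj: "scnj (scnj x) = (x :: 'k::real_or_complex)"
proof -
  have "scnj (x + scnj x) = x + scnj x" unfolding add_scnj by (rule scnj_of_real)
  then show ?thesis by (simp add: scnj_add add.commute)
qed

lemma sRe_of_real_mult: "sRe (of_real r * x) = r * sRe (x :: 'k::real_or_complex)"
proof -
  have "of_real (2 * sRe (of_real r * x)) = of_real r * (x + scnj x)"
    unfolding add_scnj[symmetric] scnj_mult scnj_of_real by (rule distrib_left[symmetric])
  also have "\<dots> = of_real (2 * (r * sRe x))" by (simp add: add_scnj)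
  finally have "2 * sRe (of_real r * x) = 2 * (r * sRe x)" by (simp only: of_real_eq_iff)
  then show ?thesis by simp
qed

lemma tendsto_sRe:
  assumes "(f \<longlongrightarrow> (a :: 'k::real_or_complex)) F"
  shows "((\<lambda>x. sRe (f x)) \<longlongrightarrow> sRe a) F"
proof (rule Lim_transform_bound[where g = "\<lambda>x. f x - a", THEN LIM_zero_cancel])
  show "\<forall>\<^sub>F x in F. norm (sRe (f x) - sRe a) \<le> norm (f x - a)"
    by (simp add: abs_sRe_le_norm flip: sRe_diff)
  show "((\<lambda>x. f x - a) \<longlongrightarrow> 0) F" using assms by (rule LIM_zero)
qed

context hilbert_space
begin

text \<open>
  The scalar inner product is determined by its real part at all scalar multiples, so adjointness
  for the real inner product of a map that is linear over the scalars is adjointness over the scalars.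
\<close>
lemma ip_eq_of_inner_adjoint:
  assumes "\<And>c x. f (smul c x) = smul c (f x)" and "\<And>x y. f x \<bullet> y = x \<bullet> g y"
  shows "ip (f x) y = ip x (g y)"
proof (rule sRe_mult_right_cancel)
  show "sRe (c * ip (f x) y) = sRe (c * ip x (g y))" for c
    unfolding ip_smul_left[symmetric] assms(1)[symmetric] sRe_ip by (rule assms(2))
qed

lemma norm_ip_le: "norm (ip x y) \<le> norm x * norm y"
proof (cases "ip x y = 0")
  case False
  have "of_real ((norm (ip x y))\<^sup>2) = ip (smul (scnj (ip x y)) x) y"
    by (simp only: mult_scnj[symmetric] ip_smul_left mult.commute)
  then have "(norm (ip x y))\<^sup>2 = smul (scnj (ip x y)) x \<bullet> y"
    by (metis sRe_ip sRe_of_real)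
  also have "\<dots> \<le> norm (ip x y) * norm x * norm y"
    using norm_cauchy_schwarz[of "smul (scnj (ip x y)) x" y] by (simp add: norm_smul norm_scnj)
  finally show ?thesis using False by (simp add: power2_eq_square mult.assoc)
qed simp

lemma bounded_ops_smul: "T \<in> bounded_ops smul \<Longrightarrow> T (smul c x) = smul c (T x)"
  by (simp add: bounded_ops_def)

lemma inner_adjoint_bounded_ops:
  assumes T: "T \<in> bounded_ops smul" and S: "\<And>x y. T x \<bullet> y = x \<bullet> blinfun_apply S y"
  shows "S \<in> bounded_ops smul"
proof -
  have "x \<bullet> S (smul c y) = x \<bullet> smul c (S y)" for c x y
  proof -
    have "x \<bullet> S (smul c y) = sRe (scnj c * ip (T x) y)"
      by (simp add: sRe_ip ip_smul_right flip: S ip_smul_right)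
    also have "ip (T x) y = ip x (S y)"
      by (rule ip_eq_of_inner_adjoint) (simp_all add: S bounded_ops_smul[OF T])
    finally show ?thesis by (simp add: sRe_ip flip: ip_smul_right)
  qed
  then have "S (smul c y) = smul c (S y)" for c y by (metis vector_eq_ldot)
  then show ?thesis by (simp add: bounded_ops_def)
qed

lemma hilbert_adjoint:
  assumes T: "T \<in> bounded_ops smul"
  shows "hilbert_adjoint smul ip T \<in> bounded_ops smul"
    and "T x \<bullet> y = x \<bullet> hilbert_adjoint smul ip T y"
proof -
  obtain S :: "'h \<Rightarrow>\<^sub>L 'h" where S: "\<And>x y. T x \<bullet> y = x \<bullet> S y"
    using inner_adjoint_exists[of T] by blast
  have S_ops: "S \<in> bounded_ops smul" by (rule inner_adjoint_bounded_ops[OF T S])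
  have "hilbert_adjoint smul ip T = S"
    unfolding hilbert_adjoint_def
  proof (rule the_equality)
    show "S \<in> bounded_ops smul \<and> (\<forall>x y. ip (T x) y = ip x (S y))"
      using S_ops ip_eq_of_inner_adjoint[of T S] S bounded_ops_smul[OF T] by blast
    fix R assume "R \<in> bounded_ops smul \<and> (\<forall>x y. ip (T x) y = ip x (blinfun_apply R y))"
    then have "x \<bullet> R y = x \<bullet> S y" for x y by (metis S sRe_ip)
    then show "R = S" by (intro blinfun_eqI) (metis vector_eq_ldot)
  qed
  with S S_ops show "hilbert_adjoint smul ip T \<in> bounded_ops smul"
    and "T x \<bullet> y = x \<bullet> hilbert_adjoint smul ip T y" by simp_all
qed

lemma positive_op_iff:
  "positive_op smul ip P \<longleftrightarrow> P \<in> bounded_ops smul \<and> positive_symmetric P"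
proof
  assume "positive_op smul ip P"
  then show "P \<in> bounded_ops smul \<and> positive_symmetric P"
    unfolding positive_op_def positive_symmetric_def by (metis sRe_ip)
next
  assume "P \<in> bounded_ops smul \<and> positive_symmetric P"
  then show "positive_op smul ip P"
    using ip_eq_of_inner_adjoint[of P P] bounded_ops_smul[of P]
    by (auto simp: positive_op_def sRe_ip positive_symmetric_def)
qed

end

lemma gram_operator_exists:
  fixes T :: "'h::{real_inner, banach} \<Rightarrow>\<^sub>L 'h"
  obtains A :: "'h \<Rightarrow>\<^sub>L 'h" where "\<And>x y. A x \<bullet> y = T x \<bullet> T y"
proof -
  obtain S :: "'h \<Rightarrow>\<^sub>L 'h" where S: "\<And>x y. T x \<bullet> y = x \<bullet> S y"
    using inner_adjoint_exists[of T] by blast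
  show ?thesis
    by (rule that[of "S o\<^sub>L T"]) (metis S blinfun_apply_blinfun_compose inner_commute)
qed

lemma gram_norm_le:
  fixes T A :: "'h::real_inner \<Rightarrow>\<^sub>L 'h"
  assumes A: "\<And>x y. A x \<bullet> y = T x \<bullet> T y" and T: "norm T \<le> 1"
  shows "norm (A x) \<le> norm (T x)"
proof (cases "A x = 0")
  case False
  have "norm (A x) * norm (A x) = T x \<bullet> T (A x)"
    unfolding A[symmetric] power2_norm_eq_inner[symmetric] by (rule power2_eq_square[symmetric])
  also have "\<dots> \<le> norm (T x) * norm (T (A x))" by (rule norm_cauchy_schwarz)
  also have "norm (T (A x)) \<le> norm (A x)"
    using norm_blinfun[of T "A x"] mult_right_mono[OF T norm_ge_zero[of "A x"]] by simp
  finally show ?thesis using False by (simp add: mult_left_mono)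
qed simp

context hilbert_space
begin

lemma gram_bounded_ops:
  assumes T: "T \<in> bounded_ops smul" and A: "\<And>x y. blinfun_apply A x \<bullet> y = T x \<bullet> T y"
  shows "A \<in> bounded_ops smul"
proof -
  have "A x \<bullet> y = hilbert_adjoint smul ip T (T x) \<bullet> y" for x y
    by (metis A hilbert_adjoint(2)[OF T] inner_commute)
  then have "A x = hilbert_adjoint smul ip T (T x)" for x by (metis vector_eq_rdot)
  then show ?thesis using hilbert_adjoint(1)[OF T] T by (simp add: bounded_ops_def)
qed

text \<open>
  The value of \<open>op_sqrt\<close> is identified by existence and uniqueness of the positive root. The root is
  linear over the scalars because multiplication by a scalar is a bounded real-linear map commuting
  with \<open>T\<^sup>* T\<close>.
\<close>
lemma norm_abs_op:
  assumes T: "T \<in> bounded_ops smul" "norm T \<le> 1"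
  shows "norm (abs_op smul ip T x) = norm (T x)"
proof -
  define A where "A = hilbert_adjoint smul ip T o\<^sub>L T"
  have A: "A u \<bullet> v = T u \<bullet> T v" for u v
    unfolding A_def blinfun_apply_blinfun_compose
    by (metis hilbert_adjoint(2)[OF T(1)] inner_commute)
  have A_ops: "A \<in> bounded_ops smul" by (rule gram_bounded_ops[OF T(1) A])
  have A_pos: "positive_symmetric A"
    by (auto simp: positive_symmetric_def A) (metis A inner_commute)
  have "norm (A u) \<le> 1 * norm u" for u
    using gram_norm_le[OF A T(2), of u] norm_blinfun[of T u]
      mult_right_mono[OF T(2) norm_ge_zero[of u]] by linarith
  then have "norm A \<le> 1" by (intro norm_blinfun_bound) simp_all
  from positive_square_root_exists[OF A_pos this]
  obtain P where P: "positive_symmetric P" "P o\<^sub>L P = A"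
    "\<And>C. C o\<^sub>L A = A o\<^sub>L C \<Longrightarrow> C o\<^sub>L P = P o\<^sub>L C" by blast
  have P_ops: "P \<in> bounded_ops smul"
  proof -
    have "P (smul c u) = smul c (P u)" for c u
    proof -
      define C where "C = op_smul smul c id_blinfun"
      have C: "C u = smul c u" for u by (simp add: C_def)
      have "C o\<^sub>L A = A o\<^sub>L C" by (rule blinfun_eqI) (simp add: C bounded_ops_smul[OF A_ops])
      then show ?thesis using P(3)[of C] by (metis C blinfun_apply_blinfun_compose)
    qed
    then show ?thesis by (simp add: bounded_ops_def)
  qed
  have "abs_op smul ip T = P"
    unfolding abs_op_def op_sqrt_def A_def[symmetric]
  proof (rule the_equality)
    show "positive_op smul ip P \<and> P o\<^sub>L P = A" using P(1,2) P_ops by (simp add: positive_op_iff)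
    fix Q assume Q: "positive_op smul ip Q \<and> Q o\<^sub>L Q = A"
    then have "A = Q o\<^sub>L Q" by simp
    then have "Q o\<^sub>L A = A o\<^sub>L Q" by (simp add: blinfun_eqI)
    then have "Q o\<^sub>L P = P o\<^sub>L Q" by (rule P(3))
    then show "Q = P"
      using positive_square_root_unique[of Q P] P(1,2) Q by (simp add: positive_op_iff)
  qed
  moreover have "(norm (P x))\<^sup>2 = (norm (T x))\<^sup>2"
  proof -
    have "P (P x) = A x" using P(2) by (metis blinfun_apply_blinfun_compose)
    moreover have "P x \<bullet> P x = P (P x) \<bullet> x" by (simp add: positive_symmetricD(1)[OF P(1)])
    ultimately show ?thesis by (simp add: power2_norm_eq_inner A)
  qed
  ultimately show ?thesis by simp
qed

end

section \<open>The isometric part of a contraction\<close>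

definition isometric_part :: "('h::real_normed_vector \<Rightarrow>\<^sub>L 'h) \<Rightarrow> 'h set" where
  "isometric_part T = {x. norm (T x) = norm x}"

text \<open>
  The orthogonal complement is written with the real inner product; for \<open>T\<close>
  linear over the scalar field the isometric part is invariant under scalars, and the complement over
  the scalar field is the same.
\<close>
definition gap_off_isometric_part :: "('h::real_inner \<Rightarrow>\<^sub>L 'h) \<Rightarrow> bool" where
  "gap_off_isometric_part T \<longleftrightarrow>
     (\<exists>\<rho><1. \<forall>z. (\<forall>v\<in>isometric_part T. z \<bullet> v = 0) \<longrightarrow> norm (T z) \<le> \<rho> * norm z)"

lemma contraction_le: "norm T \<le> 1 \<Longrightarrow> norm (blinfun_apply T x) \<le> norm x"
  using norm_blinfun[of T x] mult_right_mono[of "norm T" 1 "norm x"] by simp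

text \<open>
  The quantitative form of the fact that \<open>T\<close> is isometric at \<open>x\<close> only if \<open>A x = x\<close>, for \<open>A = T\<^sup>* T\<close>:
  expand the square and use \<open>norm (A x) \<le> norm (T x)\<close>.
\<close>
lemma norm_diff_gram_le:
  fixes T A :: "'h::real_inner \<Rightarrow>\<^sub>L 'h"
  assumes A: "\<And>x y. A x \<bullet> y = T x \<bullet> T y" and T: "norm T \<le> 1"
  shows "(norm (x - A x))\<^sup>2 \<le> (norm x)\<^sup>2 - (norm (T x))\<^sup>2"
proof -
  have "(norm (A x))\<^sup>2 \<le> (norm (T x))\<^sup>2"
    by (rule power_mono[OF gram_norm_le[OF A T]]) simp
  moreover have "A x \<bullet> x = (norm (T x))\<^sup>2" by (simp add: A power2_norm_eq_inner)
  ultimately show ?thesis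
    by (simp add: power2_norm_eq_inner inner_diff_left inner_diff_right inner_commute[of x "A x"])
qed

lemma isometric_part_eq_fixed_points:
  fixes T A :: "'h::real_inner \<Rightarrow>\<^sub>L 'h"
  assumes A: "\<And>x y. A x \<bullet> y = T x \<bullet> T y" and T: "norm T \<le> 1"
  shows "isometric_part T = {x. A x = x}"
proof (intro set_eqI iffI)
  fix x
  show "x \<in> {x. A x = x}" if "x \<in> isometric_part T"
    using norm_diff_gram_le[OF A T, of x] that by (simp add: isometric_part_def)
  show "x \<in> isometric_part T" if "x \<in> {x. A x = x}"
    using that A[of x x] by (simp add: isometric_part_def norm_eq_sqrt_inner)
qed

lemma isometric_part_closed_subspace:
  fixes T :: "'h::{real_inner, banach} \<Rightarrow>\<^sub>L 'h"
  assumes T: "norm T \<le> 1"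
  shows "closed (isometric_part T)" "subspace (isometric_part T)"
proof -
  obtain A :: "'h \<Rightarrow>\<^sub>L 'h" where A: "\<And>x y. A x \<bullet> y = T x \<bullet> T y"
    using gram_operator_exists by blast
  show "closed (isometric_part T)"
    unfolding isometric_part_def by (intro closed_Collect_eq continuous_intros)
  show "subspace (isometric_part T)"
    unfolding isometric_part_eq_fixed_points[OF A T]
    by (auto simp: subspace_def blinfun.add_right blinfun.scaleR_right)
qed

text \<open>
  \<open>T p\<close> and \<open>T q\<close> are orthogonal because \<open>T p \<bullet> T q = A p \<bullet> q = p \<bullet> q\<close>, so both norms obey Pythagoras.
\<close>
lemma isometric_decomposition:
  fixes T :: "'h::{real_inner, banach} \<Rightarrow>\<^sub>L 'h"
  assumes T: "norm T \<le> 1"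
  obtains p q where "p \<in> isometric_part T" "\<And>v. v \<in> isometric_part T \<Longrightarrow> q \<bullet> v = 0" "x = p + q"
    "(norm x)\<^sup>2 = (norm p)\<^sup>2 + (norm q)\<^sup>2" "(norm (T x))\<^sup>2 = (norm p)\<^sup>2 + (norm (T q))\<^sup>2"
proof -
  obtain p q where pq: "p \<in> isometric_part T" "\<And>v. v \<in> isometric_part T \<Longrightarrow> q \<bullet> v = 0" "x = p + q"
    using orthogonal_decomposition[OF isometric_part_closed_subspace[OF T]] by metis
  obtain A :: "'h \<Rightarrow>\<^sub>L 'h" where A: "\<And>x y. A x \<bullet> y = T x \<bullet> T y"
    using gram_operator_exists by blast
  have p0: "p \<bullet> q = 0" using pq by (metis inner_commute)
  have "A p = p" using pq(1) isometric_part_eq_fixed_points[OF A T] by simp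
  then have Tp0: "T p \<bullet> T q = 0" using p0 by (simp flip: A)
  have "norm (T p) = norm p" using pq(1) by (simp add: isometric_part_def)
  then have "(norm (T x))\<^sup>2 = (norm p)\<^sup>2 + (norm (T q))\<^sup>2"
    using norm_add_Pythagorean[of "T p" "T q"] Tp0
    by (simp add: pq(3) blinfun.add_right orthogonal_def)
  moreover have "(norm x)\<^sup>2 = (norm p)\<^sup>2 + (norm q)\<^sup>2"
    using norm_add_Pythagorean[of p q] p0 by (simp add: pq(3) orthogonal_def)
  ultimately show ?thesis using that pq by blast
qed

lemma norming_set_eq:
  "norm T = 1 \<Longrightarrow> norming_set T = {x \<in> isometric_part T. norm x = 1}"
  by (auto simp: norming_set_def isometric_part_def)

lemma (in hilbert_space) orth_complement_norming_set:
  assumes T: "T \<in> bounded_ops smul" "norm T = 1"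
  shows "orth_complement ip (norming_set T) = {z. \<forall>v\<in>isometric_part T. z \<bullet> v = 0}"
proof (intro set_eqI iffI)
  fix z
  show "z \<in> {z. \<forall>v\<in>isometric_part T. z \<bullet> v = 0}" if z: "z \<in> orth_complement ip (norming_set T)"
  proof -
    have "z \<bullet> v = 0" if v: "v \<in> isometric_part T" for v
    proof (cases "v = 0")
      case False
      then have "(1 / norm v) *\<^sub>R v \<in> norming_set T"
        using v by (simp add: norming_set_eq[OF T(2)] isometric_part_def blinfun.scaleR_right)
      then have "ip z ((1 / norm v) *\<^sub>R v) = 0" using z by (simp add: orth_complement_def)
      then have "z \<bullet> ((1 / norm v) *\<^sub>R v) = 0" by (metis sRe_ip sRe_of_real of_real_0)
      then show ?thesis using False by simp
    qed simp
    then show ?thesis by simp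
  qed
  show "z \<in> orth_complement ip (norming_set T)" if z: "z \<in> {z. \<forall>v\<in>isometric_part T. z \<bullet> v = 0}"
  proof -
    have "ip z v = 0" if "v \<in> norming_set T" for v
    proof (rule sRe_mult_right_cancel)
      fix c :: 'k
      have "smul (scnj c) v \<in> isometric_part T"
        using that by (simp add: norming_set_eq[OF T(2)] isometric_part_def
            bounded_ops_smul[OF T(1)] norm_smul)
      then have "z \<bullet> smul (scnj c) v = 0" using z by simp
      moreover have "scnj (scnj c) = c" by (rule scnj_scnj)
      ultimately show "sRe (c * ip z v) = sRe (c * 0)"
        by (metis ip_smul_right mult_zero_right of_real_0 sRe_ip sRe_of_real)
    qed
    then show ?thesis by (simp add: orth_complement_def)
  qed
qed


section \<open>The gap and maximizing sequences\<close>

lemma restricted_norm_less_one_iff_gap: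
  fixes T P :: "'h::real_inner \<Rightarrow>\<^sub>L 'h"
  assumes T: "norm T \<le> 1" and P: "\<And>x. norm (P x) = norm (T x)"
  shows "restricted_norm P {z. \<forall>v\<in>isometric_part T. z \<bullet> v = 0} < 1 \<longleftrightarrow> gap_off_isometric_part T"
proof -
  let ?W = "{x \<in> {z. \<forall>v\<in>isometric_part T. z \<bullet> v = 0}. norm x \<le> 1}"
  have W0: "0 \<in> ?W" by simp
  have bdd: "bdd_above ((\<lambda>x. norm (P x)) ` ?W)"
    using contraction_le[OF T] by (fastforce simp: P intro!: bdd_aboveI[of _ 1] intro: order_trans)
  show ?thesis
  proof
    let ?\<rho> = "restricted_norm P {z. \<forall>v\<in>isometric_part T. z \<bullet> v = 0}"
    assume "?\<rho> < 1"
    moreover have "norm (T z) \<le> ?\<rho> * norm z" if z: "\<forall>v\<in>isometric_part T. z \<bullet> v = 0" for z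
    proof (cases "z = 0")
      case False
      have "norm (P ((1 / norm z) *\<^sub>R z)) \<le> ?\<rho>"
        unfolding restricted_norm_def by (rule cSUP_upper[OF _ bdd]) (use z False in simp)
      then show ?thesis using False by (simp add: P blinfun.scaleR_right pos_divide_le_eq)
    qed simp
    ultimately show "gap_off_isometric_part T" unfolding gap_off_isometric_part_def by blast
  next
    assume "gap_off_isometric_part T"
    then obtain \<rho> where \<rho>: "\<rho> < 1"
      "\<And>z. \<forall>v\<in>isometric_part T. z \<bullet> v = 0 \<Longrightarrow> norm (T z) \<le> \<rho> * norm z"
      unfolding gap_off_isometric_part_def by blast
    have "restricted_norm P {z. \<forall>v\<in>isometric_part T. z \<bullet> v = 0} \<le> max \<rho> 0"
      unfolding restricted_norm_def
    proof (rule cSUP_least)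
      show "?W \<noteq> {}" using W0 by blast
      fix z assume z: "z \<in> ?W"
      have "norm (P z) \<le> \<rho> * norm z" using \<rho>(2)[of z] z by (simp add: P)
      also have "\<dots> \<le> max \<rho> 0 * 1" using z by (intro mult_mono) auto
      finally show "norm (P z) \<le> max \<rho> 0" by simp
    qed
    then show "restricted_norm P {z. \<forall>v\<in>isometric_part T. z \<bullet> v = 0} < 1" using \<rho>(1) by simp
  qed
qed

text \<open>
  The nearest candidate is the normalization of \<open>p\<close>, at distance \<open>\<bar>norm p - 1\<bar> \<le> norm q\<close> from \<open>p\<close>. If
  \<open>p = 0\<close>, then \<open>norm q = 1\<close> and any point of the norming set is near enough.
\<close>
lemma infdist_norming_set_le:
  fixes T :: "'h::real_inner \<Rightarrow>\<^sub>L 'h"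
  assumes T: "norm T = 1" "norming_set T \<noteq> {}"
    and p: "p \<in> isometric_part T" and x: "x = p + q" "norm x = 1"
  shows "infdist x (norming_set T) \<le> 2 * norm q"
proof (cases "p = 0")
  case True
  obtain m where m: "m \<in> norming_set T" using T(2) by blast
  have "infdist x (norming_set T) \<le> dist x m" using m by (rule infdist_le)
  also have "\<dots> \<le> norm x + norm m" by (simp add: dist_norm norm_triangle_ineq4)
  finally show ?thesis using True x m by (simp add: norming_set_def)
next
  case False
  let ?m = "(1 / norm p) *\<^sub>R p"
  have "?m \<in> norming_set T"
    using p False by (simp add: norming_set_eq[OF T(1)] isometric_part_def blinfun.scaleR_right)
  then have "infdist x (norming_set T) \<le> dist x ?m" by (rule infdist_le)
  also have "dist x ?m = norm ((p - ?m) + q)" by (simp add: dist_norm x(1) algebra_simps)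
  also have "\<dots> \<le> norm (p - ?m) + norm q" by (rule norm_triangle_ineq)
  also have "norm (p - ?m) = \<bar>norm p - 1\<bar>"
  proof -
    have "p - ?m = (1 - 1 / norm p) *\<^sub>R p" by (simp add: algebra_simps)
    then have "norm (p - ?m) = \<bar>(1 - 1 / norm p) * norm p\<bar>" by (simp add: abs_mult)
    then show ?thesis using False by (simp add: algebra_simps)
  qed
  also have "\<bar>norm p - 1\<bar> \<le> norm q"
    using norm_triangle_ineq3[of p x] x by (simp add: norm_minus_commute)
  finally show ?thesis by simp
qed

lemma gap_imp_infdist_tendsto_zero:
  fixes T :: "'h::{real_inner, banach} \<Rightarrow>\<^sub>L 'h"
  assumes T: "norm T = 1" "norming_set T \<noteq> {}" and gap: "gap_off_isometric_part T"
    and x: "maximizing_sequence T x"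
  shows "(\<lambda>n. infdist (x n) (norming_set T)) \<longlonglongrightarrow> 0"
proof -
  obtain \<rho> where \<rho>: "\<rho> < 1"
    "\<And>z. \<forall>v\<in>isometric_part T. z \<bullet> v = 0 \<Longrightarrow> norm (T z) \<le> \<rho> * norm z"
    using gap unfolding gap_off_isometric_part_def by blast
  define \<delta> where "\<delta> = 1 - (max \<rho> 0)\<^sup>2"
  have \<delta>: "0 < \<delta>" using \<rho>(1) by (auto simp: \<delta>_def max_def power_less_one_iff abs_square_less_1)
  have T1: "norm T \<le> 1" using T by simp
  \<comment> \<open>\<open>max \<rho> 0\<close>: the gap constant may be negative when the complement is trivial.\<close>
  have bound: "\<delta> * (infdist (x n) (norming_set T))\<^sup>2 \<le> 4 * (1 - (norm (T (x n)))\<^sup>2)" for n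
  proof -
    obtain p q where pq: "p \<in> isometric_part T" "\<And>v. v \<in> isometric_part T \<Longrightarrow> q \<bullet> v = 0"
      "x n = p + q" "(norm (x n))\<^sup>2 = (norm p)\<^sup>2 + (norm q)\<^sup>2"
      "(norm (T (x n)))\<^sup>2 = (norm p)\<^sup>2 + (norm (T q))\<^sup>2"
      using isometric_decomposition[OF T1, of "x n"] by metis
    have x1: "norm (x n) = 1" using x by (simp add: maximizing_sequence_def)
    have "norm (T q) \<le> \<rho> * norm q" using \<rho>(2) pq(2) by blast
    also have "\<dots> \<le> max \<rho> 0 * norm q" by (intro mult_right_mono) auto
    finally have "(norm (T q))\<^sup>2 \<le> (max \<rho> 0)\<^sup>2 * (norm q)\<^sup>2"
      using power_mono[of "norm (T q)" _ 2] by (simp flip: power_mult_distrib)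
    then have q_le: "\<delta> * (norm q)\<^sup>2 \<le> 1 - (norm (T (x n)))\<^sup>2"
      using pq(4,5) x1 by (simp add: \<delta>_def algebra_simps)
    have "(infdist (x n) (norming_set T))\<^sup>2 \<le> (2 * norm q)\<^sup>2"
      using infdist_norming_set_le[OF T pq(1,3) x1] by (intro power_mono infdist_nonneg)
    then have "\<delta> * (infdist (x n) (norming_set T))\<^sup>2 \<le> \<delta> * (4 * (norm q)\<^sup>2)"
      using \<delta> by (simp add: power_mult_distrib)
    also have "\<dots> = 4 * (\<delta> * (norm q)\<^sup>2)" by simp
    also have "\<dots> \<le> 4 * (1 - (norm (T (x n)))\<^sup>2)" using q_le by simp
    finally show ?thesis .
  qed
  have "(\<lambda>n. norm (T (x n))) \<longlonglongrightarrow> 1" using x T by (simp add: maximizing_sequence_def)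
  then have "(\<lambda>n. 4 * (1 - (norm (T (x n)))\<^sup>2)) \<longlonglongrightarrow> 4 * (1 - 1\<^sup>2)" by (intro tendsto_intros)
  then have "(\<lambda>n. 4 * (1 - (norm (T (x n)))\<^sup>2)) \<longlonglongrightarrow> 0" by simp
  then have "(\<lambda>n. \<delta> * (infdist (x n) (norming_set T))\<^sup>2) \<longlonglongrightarrow> 0"
    by (rule tendsto_sandwich[OF _ _ tendsto_const, rotated 2]) (use bound \<delta> in auto)
  then have "(\<lambda>n. (1 / \<delta>) * (\<delta> * (infdist (x n) (norming_set T))\<^sup>2)) \<longlonglongrightarrow> (1 / \<delta>) * 0"
    by (rule tendsto_mult_left)
  then have "(\<lambda>n. (infdist (x n) (norming_set T))\<^sup>2) \<longlonglongrightarrow> 0" using \<delta> by simp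
  from tendsto_real_sqrt[OF this] show ?thesis by (simp add: infdist_nonneg)
qed

lemma dist_orthogonal_unit_ge:
  fixes z :: "'h::real_inner"
  assumes "norm z = 1" "norm m = 1" "z \<bullet> m = 0"
  shows "1 \<le> dist z m"
proof -
  have "z \<bullet> (z - m) \<le> norm z * norm (z - m)" by (rule norm_cauchy_schwarz)
  then show ?thesis using assms by (simp add: inner_diff_right dist_norm norm_eq_1)
qed

lemma infdist_tendsto_zero_imp_gap:
  fixes T :: "'h::real_inner \<Rightarrow>\<^sub>L 'h"
  assumes T: "norm T = 1" "norming_set T \<noteq> {}"
    and sub: "\<And>x. maximizing_sequence T x \<Longrightarrow>
      \<exists>r. strict_mono (r :: nat \<Rightarrow> nat) \<and> (\<lambda>i. infdist (x (r i)) (norming_set T)) \<longlonglongrightarrow> 0"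
  shows "gap_off_isometric_part T"
proof (rule ccontr)
  assume no_gap: "\<not> gap_off_isometric_part T"
  have "\<exists>z. (\<forall>v\<in>isometric_part T. z \<bullet> v = 0) \<and> norm z = 1 \<and> 1 - 1 / real (Suc n) < norm (T z)" for n
  proof -
    let ?\<rho> = "1 - 1 / real (Suc n)"
    obtain z where z: "\<forall>v\<in>isometric_part T. z \<bullet> v = 0" "?\<rho> * norm z < norm (T z)"
      using no_gap unfolding gap_off_isometric_part_def
      by (metis diff_less_eq less_add_same_cancel1 not_le of_nat_0_less_iff zero_less_Suc
          zero_less_divide_1_iff)
    then have "z \<noteq> 0" by auto
    with z show ?thesis
      by (intro exI[of _ "(1 / norm z) *\<^sub>R z"])
        (simp add: blinfun.scaleR_right pos_less_divide_eq)
  qed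
  then obtain z where z: "\<And>n v. v \<in> isometric_part T \<Longrightarrow> z n \<bullet> v = 0" "\<And>n. norm (z n) = 1"
    "\<And>n. 1 - 1 / real (Suc n) < norm (T (z n))" by metis
  have "(\<lambda>n. norm (T (z n))) \<longlonglongrightarrow> 1"
  proof (rule tendsto_sandwich)
    have "(\<lambda>n. 1 - 1 / real (Suc n)) \<longlonglongrightarrow> 1 - 0"
      by (intro tendsto_intros LIMSEQ_Suc[OF lim_1_over_n])
    then show "(\<lambda>n. 1 - 1 / real (Suc n)) \<longlonglongrightarrow> 1" by simp
    show "\<forall>\<^sub>F n in sequentially. 1 - 1 / real (Suc n) \<le> norm (T (z n))"
      by (intro always_eventually allI less_imp_le z(3))
    have "norm (T (z n)) \<le> 1" for n using contraction_le[of T "z n"] T(1) z(2)[of n] by simp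
    then show "\<forall>\<^sub>F n in sequentially. norm (T (z n)) \<le> 1" by simp
  qed (rule tendsto_const)
  then have "maximizing_sequence T z" using z(2) T by (simp add: maximizing_sequence_def)
  then obtain r :: "nat \<Rightarrow> nat" where r: "(\<lambda>i. infdist (z (r i)) (norming_set T)) \<longlonglongrightarrow> 0"
    using sub by blast
  have "1 \<le> infdist (z n) (norming_set T)" for n
    unfolding infdist_notempty[OF T(2)]
    by (rule cINF_greatest[OF T(2)], rule dist_orthogonal_unit_ge)
      (use z in \<open>auto simp: norming_set_eq[OF T(1)]\<close>)
  then have "(1::real) \<le> 0" by (intro LIMSEQ_le_const[OF r]) blast
  then show False by simp
qed

section \<open>Attaining the directional derivative in the duality set\<close>

text \<open>
  Transported from \<open>\<real>\<close> or \<open>\<complex>\<close> along the isometries of \<open>real_or_complex_cases\<close>; local compactness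
  is not among the axioms of the class.
\<close>
lemma compact_scalar_cball: "compact (cball (0 :: 'k::real_or_complex) r)"
  using real_or_complex_cases[where 'k = 'k]
proof
  assume bij: "bij (of_real :: real \<Rightarrow> 'k)"
  have "cball (0 :: 'k) r = of_real ` {-r..r}"
  proof (intro set_eqI iffI)
    fix x :: 'k
    assume x: "x \<in> cball 0 r"
    obtain s where "x = of_real s" using bij by (meson bij_pointE)
    with x show "x \<in> of_real ` {-r..r}" by (intro image_eqI[of _ _ s]) auto
  qed auto
  moreover have "compact (of_real ` {-r..r} :: 'k set)"
    by (intro compact_continuous_image continuous_intros compact_Icc)
  ultimately show ?thesis by simp
next
  assume "\<exists>h :: complex \<Rightarrow> 'k. bij h \<and> (\<forall>a b. h (a + b) = h a + h b) \<and> (\<forall>a b. h (a * b) = h a * h b)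
      \<and> (\<forall>r. h (of_real r) = of_real r) \<and> (\<forall>a. norm (h a) = norm a)
      \<and> (\<forall>a. scnj (h a) = h (cnj a)) \<and> (\<forall>a. sRe (h a) = Re a)"
  then obtain h :: "complex \<Rightarrow> 'k" where h: "bij h" "\<And>a b. h (a + b) = h a + h b"
    "\<And>a. norm (h a) = norm a" by blast
  have "dist (h a) (h b) = dist a b" for a b
    using h(2)[of "a - b" b] h(3)[of "a - b"] by (simp add: dist_norm)
  then have "continuous_on (cball 0 r) h" by (auto simp: continuous_on_iff)
  then have "compact (h ` cball 0 r)" by (intro compact_continuous_image) auto
  moreover have "h ` cball 0 r = cball 0 r"
  proof (intro set_eqI iffI)
    fix x :: 'k
    assume x: "x \<in> cball 0 r"
    obtain a where "x = h a" using h(1) by (meson bij_pointE)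
    with x show "x \<in> h ` cball 0 r" by (auto simp: h(3))
  qed (auto simp: h(3))
  ultimately show ?thesis by simp
qed

text \<open>
  By Tychonoff's theorem the product of the balls is compact, so the sequence has a cluster point
  \<open>g\<close>. The product over an arbitrary index set is not sequentially compact: instead of a subsequence
  there is a filter finer than \<open>sequentially\<close>, namely the trace on the indices of the
  neighbourhoods of \<open>g\<close>. Limits along it serve the purpose of a Banach limit.
\<close>
lemma pointwise_cluster_function:
  fixes f :: "nat \<Rightarrow> 'x \<Rightarrow> 'k::real_or_complex"
  assumes bound: "\<And>n R. norm (f n R) \<le> B R"
  obtains F g where "F \<noteq> bot" "F \<le> sequentially" "\<And>R. ((\<lambda>n. f n R) \<longlongrightarrow> g R) F"
proof -
  let ?K = "PiE UNIV (\<lambda>R. cball (0 :: 'k) (B R))"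
  have "compactin (product_topology (\<lambda>_. euclidean) UNIV) ?K"
    by (simp add: compactin_PiE compact_scalar_cball)
  then have "compact ?K" by (simp add: euclidean_product_topology)
  moreover have "filtermap f sequentially \<noteq> bot" by (simp add: filtermap_bot_iff)
  moreover have "eventually (\<lambda>y. y \<in> ?K) (filtermap f sequentially)"
    unfolding eventually_filtermap using bound by (auto intro!: always_eventually PiE_I)
  ultimately obtain g where g: "inf (nhds g) (filtermap f sequentially) \<noteq> bot"
    unfolding compact_filter by blast
  let ?F = "inf sequentially (filtercomap f (nhds g))"
  have "?F \<noteq> bot"
  proof
    assume "?F = bot"
    then have "eventually (\<lambda>_. False) ?F" by simp
    then obtain P Q where P: "eventually P sequentially" and Q: "eventually Q (filtercomap f (nhds g))"
      and PQ: "\<And>n. P n \<Longrightarrow> \<not> Q n" unfolding eventually_inf by blast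
    obtain U where U: "eventually U (nhds g)" "\<And>n. U (f n) \<Longrightarrow> Q n"
      using Q unfolding eventually_filtercomap by blast
    have "eventually (\<lambda>y. \<not> U y) (filtermap f sequentially)"
      unfolding eventually_filtermap using P by eventually_elim (use PQ U in blast)
    then have "eventually (\<lambda>_. False) (inf (nhds g) (filtermap f sequentially))"
      using U(1) unfolding eventually_inf by blast
    then show False using g by (simp add: trivial_limit_def)
  qed
  moreover have "((\<lambda>n. f n R) \<longlongrightarrow> g R) ?F" for R
  proof -
    have "filterlim f (nhds g) ?F"
      by (rule filterlim_mono[OF filterlim_filtercomap]) auto
    then show ?thesis
      by (rule continuous_on_tendsto_compose[OF continuous_on_product_coordinates[of R]]) auto
  qed
  ultimately show ?thesis using that by (meson inf_le1)
qed

context hilbert_space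
begin

lemma op_smul_of_real: "op_smul smul (of_real r) S = r *\<^sub>R S"
  by (rule blinfun_eqI) (simp add: smul_of_real blinfun.scaleR_left)

lemma bounded_ops_scaleR: "S \<in> bounded_ops smul \<Longrightarrow> r *\<^sub>R S \<in> bounded_ops smul"
  using bounded_ops_closed(3)[of S "of_real r"] by (simp add: op_smul_of_real)

lemma duality_set_norm_le:
  assumes f: "f \<in> duality_set (op_smul smul) (bounded_ops smul) T" and R: "R \<in> bounded_ops smul"
  shows "norm (f R) \<le> norm R"
proof (cases "R = 0")
  case True
  obtain K where "\<forall>x\<in>bounded_ops smul. norm (f x) \<le> K * norm x"
    using f by (auto simp: duality_set_def dual_on_def)
  then show ?thesis using R True by fastforce
next
  case False
  let ?X = "{x \<in> bounded_ops smul. norm x \<le> 1}"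
  obtain K where K: "\<forall>x\<in>bounded_ops smul. norm (f x) \<le> K * norm x"
    using f by (auto simp: duality_set_def dual_on_def)
  have hom: "f (op_smul smul c x) = c * f x" if "x \<in> bounded_ops smul" for c x
    using f that by (auto simp: duality_set_def dual_on_def)
  have "norm (f x) \<le> \<bar>K\<bar>" if "x \<in> ?X" for x
  proof -
    have "norm (f x) \<le> K * norm x" using K that by simp
    also have "\<dots> \<le> \<bar>K\<bar> * 1" using that by (intro mult_mono) auto
    finally show ?thesis by simp
  qed
  then have "bdd_above ((\<lambda>x. norm (f x)) ` ?X)" by (auto intro!: bdd_aboveI[of _ "\<bar>K\<bar>"])
  then have "norm (f ((1 / norm R) *\<^sub>R R)) \<le> dual_norm_on (bounded_ops smul) f"
    unfolding dual_norm_on_def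
    by (rule cSUP_upper[rotated]) (use R False in \<open>simp add: bounded_ops_scaleR\<close>)
  also have "dual_norm_on (bounded_ops smul) f = 1" using f by (simp add: duality_set_def)
  also have "f ((1 / norm R) *\<^sub>R R) = of_real (1 / norm R) * f R"
    unfolding op_smul_of_real[symmetric] by (rule hom[OF R])
  finally show ?thesis using False by (simp add: norm_mult norm_divide pos_divide_le_eq)
qed

text \<open>
  Each functional \<open>R \<mapsto> \<langle>R x\<^sub>n, T x\<^sub>n\<rangle>\<close> is linear, bounded by \<open>norm R\<close> and equal to 1 at \<open>T\<close>. These
  properties pass to a pointwise limit along a filter, while the values at \<open>S\<close> tend to \<open>m\<close>.
\<close>
lemma duality_set_limit:
  assumes T: "T \<in> bounded_ops smul" "norm T = 1" and S: "S \<in> bounded_ops smul"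
    and x: "\<And>n. x n \<in> norming_set T" and lim: "(\<lambda>n. T (x n) \<bullet> S (x n)) \<longlonglongrightarrow> m"
  shows "m \<in> (\<lambda>f. sRe (f S)) ` duality_set (op_smul smul) (bounded_ops smul) T"
proof -
  have x1: "norm (x n) = 1" "norm (T (x n)) = 1" for n
    using x[of n] T(2) by (auto simp: norming_set_def)
  define f where "f n R = ip (blinfun_apply R (x n)) (T (x n))" for n R
  have f_le: "norm (f n R) \<le> norm R" for n R
    using norm_ip_le[of "R (x n)" "T (x n)"] norm_blinfun[of R "x n"] by (simp add: f_def x1)
  from pointwise_cluster_function[of f norm, OF f_le]
  obtain F g where F: "F \<noteq> bot" "F \<le> sequentially" and g: "\<And>R. ((\<lambda>n. f n R) \<longlongrightarrow> g R) F"
    by blast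
  have g_add: "g (Q + R) = g Q + g R" for Q R
  proof (rule tendsto_unique[OF F(1) g])
    show "((\<lambda>n. f n (Q + R)) \<longlongrightarrow> g Q + g R) F"
      using tendsto_add[OF g g, of Q R] by (simp add: f_def blinfun.add_left ip_add_left)
  qed
  have g_smul: "g (op_smul smul c R) = c * g R" for c R
  proof (rule tendsto_unique[OF F(1) g])
    show "((\<lambda>n. f n (op_smul smul c R)) \<longlongrightarrow> c * g R) F"
      using tendsto_mult_left[OF g, of c R] by (simp add: f_def ip_smul_left)
  qed
  have g_le: "norm (g R) \<le> norm R" for R
    by (rule tendsto_upperbound[OF tendsto_norm[OF g] _ F(1)]) (simp add: f_le)
  have "f n T = 1" for n by (simp add: f_def ip_self x1)
  then have gT: "g T = 1" using tendsto_unique[OF F(1) g, of T 1] by simp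
  have "dual_norm_on (bounded_ops smul) g = 1"
    unfolding dual_norm_on_def
  proof (rule cSup_eq_maximum)
    show "1 \<in> (\<lambda>x. norm (g x)) ` {x \<in> bounded_ops smul. norm x \<le> 1}"
      using T gT by (intro image_eqI[of _ _ T]) auto
    show "y \<le> 1" if "y \<in> (\<lambda>x. norm (g x)) ` {x \<in> bounded_ops smul. norm x \<le> 1}" for y
      using that g_le order_trans by blast
  qed
  moreover have "g \<in> dual_on (op_smul smul) (bounded_ops smul)"
    unfolding dual_on_def using g_add g_smul g_le by (auto intro!: exI[of _ 1])
  ultimately have "g \<in> duality_set (op_smul smul) (bounded_ops smul) T"
    using T(2) gT by (simp add: duality_set_def)
  moreover have "m = sRe (g S)"
  proof (rule tendsto_unique[OF F(1)])
    show "((\<lambda>n. sRe (f n S)) \<longlongrightarrow> sRe (g S)) F" by (rule tendsto_sRe[OF g])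
    have "sRe (f n S) = T (x n) \<bullet> S (x n)" for n by (simp add: f_def sRe_ip inner_commute)
    then show "((\<lambda>n. sRe (f n S)) \<longlongrightarrow> m) F" using tendsto_mono[OF F(2) lim] by simp
  qed
  ultimately show ?thesis by blast
qed

end


section \<open>The gap and strong subdifferentiability\<close>

text \<open>Bounds on squares are turned into bounds on norms through \<open>1 + 2 a \<le> (1 + a)\<^sup>2\<close>.\<close>
lemma norm_le_of_square_bound:
  fixes U :: "'h::real_normed_vector \<Rightarrow>\<^sub>L 'g::real_normed_vector"
  assumes sq: "\<And>y. norm y = 1 \<Longrightarrow> (norm (U y))\<^sup>2 \<le> 1 + 2 * a" and a: "-1 \<le> a"
  shows "norm U \<le> 1 + a"
proof (rule norm_blinfun_bound)
  fix x
  show "norm (U x) \<le> (1 + a) * norm x"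
  proof (cases "x = 0")
    case False
    let ?y = "(1 / norm x) *\<^sub>R x"
    have "(norm (U ?y))\<^sup>2 \<le> 1 + 2 * a" using False by (intro sq) simp
    also have "\<dots> \<le> (1 + a)\<^sup>2" by (simp add: power2_sum)
    finally have "norm (U ?y) \<le> 1 + a" by (rule power2_le_imp_le) (use a in simp)
    then show ?thesis using False by (simp add: blinfun.scaleR_right pos_divide_le_eq)
  qed simp
qed (use a in simp)

lemma norm_perturbation_square:
  fixes T S :: "'h::real_inner \<Rightarrow>\<^sub>L 'h"
  shows "(norm ((T + t *\<^sub>R S) y))\<^sup>2 = (norm (T y))\<^sup>2 + 2 * t * (T y \<bullet> S y) + t\<^sup>2 * (norm (S y))\<^sup>2"
  unfolding power2_norm_eq_inner blinfun.add_left blinfun.scaleR_left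
  by (simp add: inner_add_left inner_add_right inner_commute[of "S y" "T y"] power2_eq_square
      algebra_simps)

text \<open>
  The main estimate. Split a unit vector as \<open>y = p + q\<close> along the isometric part and put
  \<open>\<delta> = 1 - \<rho>\<^sup>2\<close>. The gap costs \<open>\<delta> (norm q)\<^sup>2\<close> in \<open>(norm (T y))\<^sup>2\<close>, whereas replacing \<open>T y \<bullet> S y\<close> by \<open>m\<close>
  gains at most \<open>4 norm q\<close>: one for each of the three terms of \<open>T y \<bullet> S y\<close> that contain \<open>q\<close>, and one
  since \<open>(norm p)\<^sup>2\<close> falls short of 1. The maximum of \<open>8 t (norm q) - \<delta> (norm q)\<^sup>2\<close> is \<open>16 t\<^sup>2 / \<delta>\<close>, of
  second order in \<open>t\<close>, with a constant that does not depend on \<open>S\<close>.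
\<close>
lemma norm_perturbation_le:
  fixes T S :: "'h::{real_inner, banach} \<Rightarrow>\<^sub>L 'h"
  assumes T: "norm T = 1" and S: "norm S \<le> 1" and \<rho>: "0 \<le> \<rho>" "\<rho> < 1"
    and gap: "\<And>z. \<forall>v\<in>isometric_part T. z \<bullet> v = 0 \<Longrightarrow> norm (T z) \<le> \<rho> * norm z"
    and m: "\<And>x. x \<in> norming_set T \<Longrightarrow> T x \<bullet> S x \<le> m" "-1 \<le> m"
    and t: "0 \<le> t" "t \<le> 1"
  shows "norm (T + t *\<^sub>R S) \<le> 1 + t * m + (1 + 16 / (1 - \<rho>\<^sup>2)) / 2 * t\<^sup>2"
proof -
  define \<delta> where "\<delta> = 1 - \<rho>\<^sup>2"
  have \<delta>: "0 < \<delta>" using \<rho> by (simp add: \<delta>_def power_less_one_iff abs_square_less_1)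
  define a where "a = t * m + (1 + 16 / \<delta>) / 2 * t\<^sup>2"
  have T1: "norm T \<le> 1" using T by simp
  have "norm (T + t *\<^sub>R S) \<le> 1 + a"
  proof (rule norm_le_of_square_bound)
    have "0 \<le> (1 + 16 / \<delta>) / 2 * t\<^sup>2" using \<delta> by simp
    moreover have "-1 \<le> t * m" using mult_left_mono[OF m(2) t(1)] t(2) by simp
    ultimately show "-1 \<le> a" unfolding a_def by (rule add_increasing2)
    fix y :: 'h
    assume y: "norm y = 1"
    obtain p q where pq: "p \<in> isometric_part T" "\<And>v. v \<in> isometric_part T \<Longrightarrow> q \<bullet> v = 0"
      "y = p + q" "(norm y)\<^sup>2 = (norm p)\<^sup>2 + (norm q)\<^sup>2"
      "(norm (T y))\<^sup>2 = (norm p)\<^sup>2 + (norm (T q))\<^sup>2"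
      using isometric_decomposition[OF T1, of y] by metis
    have p1: "(norm p)\<^sup>2 = 1 - (norm q)\<^sup>2" using pq(4) y by simp
    then have "(norm p)\<^sup>2 \<le> 1\<^sup>2" "(norm q)\<^sup>2 \<le> 1\<^sup>2"
      using zero_le_power2[of "norm p"] zero_le_power2[of "norm q"] by simp_all
    then have le1: "norm p \<le> 1" "norm q \<le> 1" by (simp_all add: abs_square_le_1)
    have "norm (T q) \<le> \<rho> * norm q" using gap pq(2) by blast
    then have "(norm (T q))\<^sup>2 \<le> \<rho>\<^sup>2 * (norm q)\<^sup>2"
      using power_mono[of "norm (T q)" _ 2] by (simp flip: power_mult_distrib)
    then have Ty: "(norm (T y))\<^sup>2 \<le> 1 - \<delta> * (norm q)\<^sup>2"
      using pq(5) p1 by (simp add: \<delta>_def algebra_simps)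
    have Tpp: "T p \<bullet> S p \<le> m + norm q"
    proof -
      have "T p \<bullet> S p \<le> (norm p)\<^sup>2 * m"
      proof (cases "p = 0")
        case False
        have "(1 / norm p) *\<^sub>R p \<in> norming_set T"
          using pq(1) False
          by (simp add: norming_set_eq[OF T] isometric_part_def blinfun.scaleR_right)
        from m(1)[OF this] have "(T p \<bullet> S p) / (norm p)\<^sup>2 \<le> m"
          by (simp add: blinfun.scaleR_right power2_eq_square)
        then show ?thesis using False by (simp add: pos_divide_le_eq mult.commute)
      qed simp
      also have "\<dots> = m - (norm q)\<^sup>2 * m" by (simp add: p1 algebra_simps)
      also have "\<dots> \<le> m + (norm q)\<^sup>2"
        using mult_left_mono[OF m(2), of "(norm q)\<^sup>2"] by simp
      also have "(norm q)\<^sup>2 \<le> norm q"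
        using mult_left_le[OF le1(2) norm_ge_zero] by (simp add: power2_eq_square)
      finally show ?thesis by simp
    qed
    have cross: "T u \<bullet> S v \<le> norm q" if "norm u \<le> 1 \<and> v = q \<or> u = q \<and> norm v \<le> 1" for u v
    proof -
      have "T u \<bullet> S v \<le> norm (T u) * norm (S v)" by (rule norm_cauchy_schwarz)
      also have "\<dots> \<le> norm u * norm v"
        by (intro mult_mono contraction_le T1 S norm_ge_zero)
      also have "\<dots> \<le> norm q"
        using that mult_right_mono[of "norm u" 1 "norm q"] mult_left_mono[of "norm v" 1 "norm q"]
        by auto
      finally show ?thesis .
    qed
    have "T y \<bullet> S y = T p \<bullet> S p + T p \<bullet> S q + T q \<bullet> S p + T q \<bullet> S q"
      by (simp add: pq(3) blinfun.add_right inner_add_left inner_add_right)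
    also have "\<dots> \<le> (m + norm q) + norm q + norm q + norm q"
      using le1 by (intro add_mono Tpp cross) auto
    finally have "2 * t * (T y \<bullet> S y) \<le> 2 * t * (m + 4 * norm q)"
      using t(1) by (intro mult_left_mono) auto
    moreover have "t\<^sup>2 * (norm (S y))\<^sup>2 \<le> t\<^sup>2 * 1"
      using contraction_le[OF S, of y] y by (intro mult_left_mono) (auto simp: power_le_one)
    moreover have "8 * t * norm q - \<delta> * (norm q)\<^sup>2 \<le> 16 / \<delta> * t\<^sup>2"
    proof -
      have "0 \<le> (\<delta> * norm q - 4 * t)\<^sup>2 / \<delta>" using \<delta> by simp
      also have "\<dots> = \<delta> * (norm q)\<^sup>2 - 8 * t * norm q + 16 / \<delta> * t\<^sup>2"
        using \<delta> by (simp add: power2_eq_square field_simps)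
      finally show ?thesis by simp
    qed
    ultimately have "(norm (T y))\<^sup>2 + 2 * t * (T y \<bullet> S y) + t\<^sup>2 * (norm (S y))\<^sup>2
        \<le> 1 + 2 * t * m + t\<^sup>2 + 16 / \<delta> * t\<^sup>2"
      using Ty by (simp add: algebra_simps)
    also have "\<dots> = 1 + 2 * a" by (simp add: a_def algebra_simps)
    finally show "(norm ((T + t *\<^sub>R S) y))\<^sup>2 \<le> 1 + 2 * a" unfolding norm_perturbation_square .
  qed
  then show ?thesis by (simp add: a_def \<delta>_def)
qed

context hilbert_space
begin

text \<open>
  The supremum of \<open>T x \<bullet> S x\<close> over the norming set lies between the difference quotient minus \<open>C t\<close>
  and the difference quotient itself, so it is the uniform limit of the quotients. Members of the duality set lie below
  every difference quotient, hence below this supremum; \<open>duality_set_limit\<close> shows that it is attained.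
\<close>
lemma gap_imp_strongly_subdifferentiable:
  assumes T: "T \<in> bounded_ops smul" "norm T = 1" and ne: "norming_set T \<noteq> {}"
    and gap: "gap_off_isometric_part T"
  shows "strongly_subdifferentiable (op_smul smul) (bounded_ops smul) T"
proof -
  obtain \<rho>' where \<rho>': "\<rho>' < 1"
    "\<And>z. \<forall>v\<in>isometric_part T. z \<bullet> v = 0 \<Longrightarrow> norm (T z) \<le> \<rho>' * norm z"
    using gap unfolding gap_off_isometric_part_def by blast
  define \<rho> where "\<rho> = max \<rho>' 0"
  have \<rho>: "0 \<le> \<rho>" "\<rho> < 1" using \<rho>'(1) by (auto simp: \<rho>_def)
  have gap_\<rho>: "norm (T z) \<le> \<rho> * norm z" if "\<forall>v\<in>isometric_part T. z \<bullet> v = 0" for z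
    using \<rho>'(2)[OF that] mult_right_mono[of \<rho>' \<rho> "norm z"] by (simp add: \<rho>_def)
  define C where "C = (1 + 16 / (1 - \<rho>\<^sup>2)) / 2"
  have C: "0 < C"
    using \<rho> by (auto simp: C_def abs_square_le_1 intro!: add_pos_nonneg)
  define m where "m S = (SUP x\<in>norming_set T. T x \<bullet> blinfun_apply S x)" for S
  let ?X = "bounded_ops smul \<inter> cball 0 1"
  let ?quot = "\<lambda>t S. (norm (T + t *\<^sub>R S) - norm T) / t"
  have abs_le: "\<bar>T x \<bullet> S x\<bar> \<le> 1" if "S \<in> ?X" "x \<in> norming_set T" for S x
  proof -
    have "\<bar>T x \<bullet> S x\<bar> \<le> norm (T x) * norm (S x)" by (rule Cauchy_Schwarz_ineq2)
    also have "\<dots> \<le> 1" using that T(2) contraction_le[of S x] by (simp add: norming_set_def)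
    finally show ?thesis .
  qed
  have le_m: "T x \<bullet> S x \<le> m S" if "S \<in> ?X" "x \<in> norming_set T" for S x
    unfolding m_def
    by (rule cSUP_upper[OF that(2)]) (use abs_le[OF that(1)] in \<open>fastforce intro!: bdd_aboveI[of _ 1]\<close>)
  have m_ge: "-1 \<le> m S" if "S \<in> ?X" for S
  proof -
    obtain x where "x \<in> norming_set T" using ne by blast
    then show ?thesis using le_m[OF that] abs_le[OF that] by fastforce
  qed
  have lower: "m S \<le> ?quot t S" if "S \<in> ?X" "0 < t" for S t
    unfolding m_def
  proof (rule cSUP_least[OF ne])
    fix x assume "x \<in> norming_set T"
    then have x: "norm x = 1" "norm (T x) = 1" using T(2) by (simp_all add: norming_set_def)
    have "1 + t * (T x \<bullet> S x) = T x \<bullet> (T + t *\<^sub>R S) x"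
      using x(2) by (simp add: blinfun.add_left blinfun.scaleR_left inner_add_right norm_eq_1)
    also have "\<dots> \<le> norm (T x) * norm ((T + t *\<^sub>R S) x)" by (rule norm_cauchy_schwarz)
    also have "\<dots> \<le> norm (T + t *\<^sub>R S)" using norm_blinfun[of "T + t *\<^sub>R S" x] x by simp
    finally show "T x \<bullet> S x \<le> ?quot t S"
      using that(2) T(2) by (simp add: pos_le_divide_eq mult.commute)
  qed
  have upper: "?quot t S \<le> m S + C * t" if "S \<in> ?X" "0 < t" "t \<le> 1" for S t
  proof -
    have "norm (T + t *\<^sub>R S) \<le> 1 + t * m S + C * t\<^sup>2"
      unfolding C_def
      by (rule norm_perturbation_le[OF T(2) _ \<rho> gap_\<rho>]) (use that le_m m_ge in auto)
    then show ?thesis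
      using that(2) T(2) by (simp add: pos_divide_le_eq power2_eq_square algebra_simps)
  qed
  have max: "is_max ((\<lambda>f. sRe (f S)) ` duality_set (op_smul smul) (bounded_ops smul) T) (m S)"
    if S: "S \<in> ?X" for S
    unfolding is_max_def
  proof
    have "\<exists>x\<in>norming_set T. m S - 1 / real (Suc n) < T x \<bullet> S x" for n
      using less_cSupD[of "(\<lambda>x. T x \<bullet> S x) ` norming_set T" "m S - 1 / real (Suc n)"] ne
      by (auto simp: m_def)
    then obtain x where x: "\<And>n. x n \<in> norming_set T"
      "\<And>n. m S - 1 / real (Suc n) < T (x n) \<bullet> S (x n)" by metis
    have "(\<lambda>n. T (x n) \<bullet> S (x n)) \<longlonglongrightarrow> m S"
    proof (rule tendsto_sandwich[OF _ _ _ tendsto_const])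
      have "(\<lambda>n. m S - 1 / real (Suc n)) \<longlonglongrightarrow> m S - 0"
        by (intro tendsto_intros LIMSEQ_Suc[OF lim_1_over_n])
      then show "(\<lambda>n. m S - 1 / real (Suc n)) \<longlonglongrightarrow> m S" by simp
      show "\<forall>\<^sub>F n in sequentially. m S - 1 / real (Suc n) \<le> T (x n) \<bullet> S (x n)"
        by (intro always_eventually allI less_imp_le x(2))
      show "\<forall>\<^sub>F n in sequentially. T (x n) \<bullet> S (x n) \<le> m S"
        by (intro always_eventually allI le_m S x(1))
    qed
    then show "m S \<in> (\<lambda>f. sRe (f S)) ` duality_set (op_smul smul) (bounded_ops smul) T"
      using duality_set_limit[OF T, of S x] S x(1) by blast
    show "\<forall>a\<in>(\<lambda>f. sRe (f S)) ` duality_set (op_smul smul) (bounded_ops smul) T. a \<le> m S"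
    proof (clarify)
      fix f assume f: "f \<in> duality_set (op_smul smul) (bounded_ops smul) T"
      have le_quot: "sRe (f S) \<le> ?quot t S" if "0 < t" for t
      proof -
        have tS: "t *\<^sub>R S \<in> bounded_ops smul" using S by (simp add: bounded_ops_scaleR)
        have "f (T + t *\<^sub>R S) = f T + of_real t * f S"
          using f T(1) S tS unfolding op_smul_of_real[symmetric]
          by (auto simp: duality_set_def dual_on_def)
        also have "\<dots> = 1 + of_real t * f S" using f T(2) by (simp add: duality_set_def)
        finally have "sRe (f (T + t *\<^sub>R S)) = 1 + t * sRe (f S)"
          using sRe_of_real[of 1, where 'k = 'k] by (simp add: sRe_add sRe_of_real_mult)
        moreover have "sRe (f (T + t *\<^sub>R S)) \<le> norm (T + t *\<^sub>R S)"
          using duality_set_norm_le[OF f bounded_ops_closed(2)[OF T(1) tS]]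
            abs_sRe_le_norm[of "f (T + t *\<^sub>R S)"] by linarith
        ultimately show ?thesis using that T(2) by (simp add: pos_le_divide_eq mult.commute)
      qed
      show "sRe (f S) \<le> m S"
      proof (rule field_le_epsilon)
        fix e :: real assume e: "0 < e"
        define t where "t = min 1 (e / C)"
        have t: "0 < t" "t \<le> 1" "C * t \<le> e"
          using e C by (auto simp: t_def min_def field_simps)
        show "sRe (f S) \<le> m S + e" using le_quot[OF t(1)] upper[OF S t(1,2)] t(3) by linarith
      qed
    qed
  qed
  have "uniform_limit ?X ?quot m (at_right 0)"
    unfolding uniform_limit_iff
  proof (intro allI impI)
    fix e :: real assume e: "0 < e"
    have "0 < min 1 (e / C)" using e C by simp
    then have "\<forall>\<^sub>F t in at_right 0. t \<in> {0<..<min 1 (e / C)}" by (rule eventually_at_right_real)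
    then show "\<forall>\<^sub>F t in at_right 0. \<forall>S\<in>?X. dist (?quot t S) (m S) < e"
    proof (rule eventually_mono, intro ballI)
      fix t S assume t: "t \<in> {0<..<min 1 (e / C)}" and S: "S \<in> ?X"
      have "C * t < e" using t C by (simp add: pos_less_divide_eq mult.commute)
      then show "dist (?quot t S) (m S) < e"
        using lower[OF S, of t] upper[OF S, of t] t by (simp add: dist_real_def)
    qed
  qed
  then show ?thesis unfolding strongly_subdifferentiable_def using max by blast
qed

definition rank_one :: "'h \<Rightarrow> 'h \<Rightarrow> ('h \<Rightarrow>\<^sub>L 'h)" where
  "rank_one z u = Blinfun (\<lambda>x. smul (ip x z) u)"

lemma rank_one_apply: "rank_one z u x = smul (ip x z) u"
proof -
  have "bounded_linear (\<lambda>x. smul (ip x z) u)"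
  proof (rule bounded_linear_intro[where K = "norm z * norm u"])
    show "smul (ip (r *\<^sub>R x) z) u = r *\<^sub>R smul (ip x z) u" for r x
      by (simp add: ip_smul_left flip: smul_of_real)
    show "norm (smul (ip x z) u) \<le> norm x * (norm z * norm u)" for x
      using mult_right_mono[OF norm_ip_le[of x z] norm_ge_zero[of u]]
      by (simp add: norm_smul mult.assoc)
  qed (simp add: ip_add_left scale_left_distrib)
  then show ?thesis by (simp add: rank_one_def bounded_linear_Blinfun_apply)
qed

lemma rank_one_bounded_ops: "rank_one z u \<in> bounded_ops smul"
  by (simp add: bounded_ops_def rank_one_apply ip_smul_left)

lemma norm_rank_one_le: "norm (rank_one z u) \<le> norm z * norm u"
proof (rule norm_blinfun_bound)
  show "norm (rank_one z u x) \<le> norm z * norm u * norm x" for x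
    using mult_right_mono[OF norm_ip_le[of x z] norm_ge_zero[of u]]
    by (simp add: rank_one_apply norm_smul mult_ac)
qed simp

text \<open>
  For a unit vector \<open>x\<close> put \<open>c = norm (x - A x)\<close>. Then \<open>(norm (T x))\<^sup>2 \<le> 1 - c\<^sup>2\<close>, and the first-order
  term is at most \<open>2 t c (norm w)\<close> because \<open>\<langle>x, z\<rangle> = \<langle>x - A x, w\<rangle>\<close>. The loss \<open>c\<^sup>2\<close> absorbs it up to
  \<open>t\<^sup>2 (norm w)\<^sup>2\<close>, so the norm grows only to second order in this direction. The constant depends on
  \<open>w\<close>, that is, on the direction: this is what uniformity will contradict.
\<close>
lemma norm_rank_one_perturbation_le:
  assumes T: "T \<in> bounded_ops smul" "norm T = 1"
    and A: "\<And>x y. blinfun_apply A x \<bullet> y = T x \<bullet> T y"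
    and z: "z = w - A w" "norm z = 1" and t: "0 \<le> t"
  shows "norm (T + t *\<^sub>R rank_one z (T z)) \<le> 1 + (1 + (norm w)\<^sup>2) / 2 * t\<^sup>2"
proof (rule norm_le_of_square_bound)
  have T1: "norm T \<le> 1" using T(2) by simp
  let ?S = "rank_one z (T z)"
  fix x :: 'h
  assume x: "norm x = 1"
  define c where "c = norm (x - A x)"
  have Tz: "norm (T z) \<le> 1" using contraction_le[OF T1, of z] z(2) by simp
  have Tx: "norm (T x) \<le> 1" using contraction_le[OF T1, of x] x by simp
  have "norm ?S \<le> 1" using norm_rank_one_le[of z "T z"] z(2) Tz by simp
  then have "norm (?S x) \<le> 1" using contraction_le[of ?S x] x by simp
  then have "t\<^sup>2 * (norm (?S x))\<^sup>2 \<le> t\<^sup>2 * 1" by (intro mult_left_mono) (auto simp: power_le_one)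
  moreover have "(norm (T x))\<^sup>2 \<le> 1 - c\<^sup>2"
    using norm_diff_gram_le[OF A T1, of x] x by (simp add: c_def)
  moreover have "2 * t * (T x \<bullet> ?S x) \<le> 2 * t * (c * norm w)"
  proof (intro mult_left_mono)
    have A_smul: "A (smul a u) = smul a (A u)" for a u
      by (rule bounded_ops_smul[OF gram_bounded_ops[OF T(1) A]])
    have "ip x z = ip (x - A x) w"
      unfolding z(1)
      by (rule ip_eq_of_inner_adjoint[symmetric, where f = "\<lambda>x. x - A x" and g = "\<lambda>x. x - A x"])
        (simp_all add: A_smul scale_right_diff_distrib inner_diff_left inner_diff_right A
          inner_commute[of _ "A _"] inner_commute[of "T _" "T _"])
    then have ip_le: "norm (ip x z) \<le> c * norm w" using norm_ip_le[of "x - A x" w] by (simp add: c_def)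
    have "T x \<bullet> ?S x \<le> norm (T x) * norm (?S x)" by (rule norm_cauchy_schwarz)
    also have "\<dots> \<le> 1 * (norm (ip x z) * 1)"
      using Tx Tz by (intro mult_mono) (auto simp: rank_one_apply norm_smul intro: mult_left_le)
    finally show "T x \<bullet> ?S x \<le> c * norm w" using ip_le by simp
  qed (use t in simp)
  moreover have "2 * t * (c * norm w) \<le> c\<^sup>2 + t\<^sup>2 * (norm w)\<^sup>2"
    using zero_le_power2[of "c - t * norm w"]
    by (simp add: power2_diff power_mult_distrib algebra_simps)
  ultimately have "(norm (T x))\<^sup>2 + 2 * t * (T x \<bullet> ?S x) + t\<^sup>2 * (norm (?S x))\<^sup>2
      \<le> 1 + t\<^sup>2 * (norm w)\<^sup>2 + t\<^sup>2"
    by simp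
  also have "\<dots> = 1 + 2 * ((1 + (norm w)\<^sup>2) / 2 * t\<^sup>2)" by (simp add: algebra_simps)
  finally show "(norm ((T + t *\<^sub>R ?S) x))\<^sup>2 \<le> 1 + 2 * ((1 + (norm w)\<^sup>2) / 2 * t\<^sup>2)"
    unfolding norm_perturbation_square .
next
  have "0 \<le> (1 + (norm w)\<^sup>2) / 2 * t\<^sup>2" by simp
  then show "-1 \<le> (1 + (norm w)\<^sup>2) / 2 * t\<^sup>2" by linarith
qed

end

lemma subspace_closure:
  fixes V :: "'a::real_normed_vector set"
  assumes V: "subspace V"
  shows "subspace (closure V)"
proof (rule subspaceI)
  show "0 \<in> closure V" using V closure_subset subspace_0 by blast
  fix u v assume "u \<in> closure V" "v \<in> closure V"
  then obtain f g where f: "\<forall>n. f n \<in> V" "f \<longlonglongrightarrow> u" and g: "\<forall>n. g n \<in> V" "g \<longlonglongrightarrow> v"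
    unfolding closure_sequential by blast
  then have "\<forall>n. f n + g n \<in> V" using V by (simp add: subspace_add)
  then show "u + v \<in> closure V"
    unfolding closure_sequential
    using tendsto_add[OF f(2) g(2)] by (intro exI[of _ "\<lambda>n. f n + g n"]) simp
next
  fix c u assume "u \<in> closure V"
  then obtain f where f: "\<forall>n. f n \<in> V" "f \<longlonglongrightarrow> u" unfolding closure_sequential by blast
  then have "\<forall>n. c *\<^sub>R f n \<in> V" using V by (simp add: subspace_scale)
  then show "c *\<^sub>R u \<in> closure V"
    unfolding closure_sequential
    using tendsto_scaleR[OF tendsto_const f(2)] by (intro exI[of _ "\<lambda>n. c *\<^sub>R f n"]) simp
qed

text \<open>The orthogonal complement of the range of the symmetric operator \<open>1 - A\<close> is its kernel.\<close>
lemma range_defect_dense: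
  fixes A :: "'h::{real_inner, banach} \<Rightarrow>\<^sub>L 'h"
  assumes sym: "\<And>x y. A x \<bullet> y = x \<bullet> A y" and z: "\<And>v. A v = v \<Longrightarrow> z \<bullet> v = 0"
  shows "z \<in> closure (range (\<lambda>w. w - A w))"
proof -
  let ?R = "range (\<lambda>w. w - A w)"
  have "linear (\<lambda>w. w - A w)"
    by (intro linear_compose_sub linear_id[unfolded id_def] bounded_linear.linear
        blinfun.bounded_linear_right)
  then have "subspace ?R" using linear_subspace_image[OF _ subspace_UNIV] by blast
  then have R: "closed (closure ?R)" "subspace (closure ?R)" by (simp_all add: subspace_closure)
  obtain p q where p: "p \<in> closure ?R" and q: "\<And>v. v \<in> closure ?R \<Longrightarrow> q \<bullet> v = 0"
    and zpq: "z = p + q"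
    using orthogonal_decomposition[OF R] by metis
  have "(q - A q) \<bullet> w = 0" for w
  proof -
    have "(q - A q) \<bullet> w = q \<bullet> (w - A w)" by (simp add: inner_diff_left inner_diff_right sym)
    then show ?thesis using q closure_subset[of ?R] by auto
  qed
  then have "q - A q = 0" by (metis inner_eq_zero_iff)
  then have "z \<bullet> q = 0" using z by simp
  moreover have "p \<bullet> q = 0" using q[OF p] by (simp add: inner_commute)
  ultimately have "q = 0" by (simp add: zpq inner_add_left)
  then show ?thesis using p zpq by simp
qed

context hilbert_space
begin

text \<open>
  Uniformity provides one \<open>t > 0\<close> at which every difference quotient exceeds its limit by at most
  \<open>1 / 2\<close>. In the direction \<open>rank_one z (T z)\<close> with \<open>z\<close> a unit vector in the range of \<open>1 - A\<close> the limit
  is at most 0, while \<open>norm (T + t S) \<ge> (1 + t) norm (T z)\<close>. This gives the constant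
  \<open>\<rho> = (1 + t / 2) / (1 + t)\<close>, and density extends the bound to the complement of the isometric part.
\<close>
lemma strongly_subdifferentiable_imp_bound_off_isometric_part:
  assumes T: "T \<in> bounded_ops smul" "norm T = 1"
    and ssd: "strongly_subdifferentiable (op_smul smul) (bounded_ops smul) T"
  obtains \<rho> where "\<rho> < 1" "\<And>z. \<forall>v\<in>isometric_part T. z \<bullet> v = 0 \<Longrightarrow> norm (T z) \<le> \<rho> * norm z"
proof -
  have T1: "norm T \<le> 1" using T(2) by simp
  obtain A :: "'h \<Rightarrow>\<^sub>L 'h" where A: "\<And>x y. A x \<bullet> y = T x \<bullet> T y"
    using gram_operator_exists by blast
  let ?X = "bounded_ops smul \<inter> cball 0 1"
  let ?quot = "\<lambda>t S. (norm (T + t *\<^sub>R S) - norm T) / t"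
  obtain m where m: "uniform_limit ?X ?quot m (at_right 0)"
    using ssd unfolding strongly_subdifferentiable_def by blast
  have "\<forall>\<^sub>F t in at_right 0. \<forall>S\<in>?X. dist (?quot t S) (m S) < 1 / 2"
    using m unfolding uniform_limit_iff by (meson half_gt_zero_iff zero_less_one)
  then obtain b :: real where b: "0 < b" "\<And>t. 0 < t \<Longrightarrow> t < b \<Longrightarrow> \<forall>S\<in>?X. dist (?quot t S) (m S) < 1 / 2"
    unfolding eventually_at_right_field by auto
  define t where "t = b / 2"
  have t: "0 < t" "\<And>S. S \<in> ?X \<Longrightarrow> ?quot t S \<le> m S + 1 / 2"
  proof -
    show "0 < t" using b(1) by (simp add: t_def)
    fix S assume "S \<in> ?X"
    moreover have "\<forall>S\<in>?X. dist (?quot t S) (m S) < 1 / 2" by (rule b(2)) (use b(1) in \<open>simp_all add: t_def\<close>)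
    ultimately have "dist (?quot t S) (m S) < 1 / 2" by blast
    then show "?quot t S \<le> m S + 1 / 2" unfolding dist_real_def by linarith
  qed
  define \<rho> where "\<rho> = (1 + t / 2) / (1 + t)"
  have \<rho>: "\<rho> < 1" using t(1) by (simp add: \<rho>_def)
  have unit: "norm (T z) \<le> \<rho>" if z: "z = w - A w" "norm z = 1" for z w
  proof -
    let ?S = "rank_one z (T z)"
    have S: "?S \<in> ?X"
      using rank_one_bounded_ops norm_rank_one_le[of z "T z"] contraction_le[OF T1, of z] z(2) by auto
    have "m ?S \<le> 0"
    proof (rule tendsto_le)
      show "((\<lambda>s. ?quot s ?S) \<longlongrightarrow> m ?S) (at_right 0)" by (rule tendsto_uniform_limitI[OF m S])
      show "((\<lambda>s. (1 + (norm w)\<^sup>2) / 2 * s) \<longlongrightarrow> 0) (at_right 0)"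
        by (rule tendsto_mult_right_zero[OF tendsto_ident_at])
      have "?quot s ?S \<le> (1 + (norm w)\<^sup>2) / 2 * s" if "0 < s" for s
      proof -
        have "norm (T + s *\<^sub>R ?S) \<le> 1 + (1 + (norm w)\<^sup>2) / 2 * s\<^sup>2"
          using norm_rank_one_perturbation_le[OF T A z, of s] that by simp
        then show ?thesis using that T(2) by (simp add: pos_divide_le_eq power2_eq_square)
      qed
      then show "\<forall>\<^sub>F s in at_right 0. ?quot s ?S \<le> (1 + (norm w)\<^sup>2) / 2 * s"
        by (rule eventually_at_rightI[of 0 1]) auto
    qed simp
    then have "m ?S + 1 / 2 \<le> 1 / 2" by simp
    with t(2)[OF S] have "?quot t ?S \<le> 1 / 2" by (rule order_trans)
    then have norm_le: "norm (T + t *\<^sub>R ?S) \<le> 1 + t / 2"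
      using t(1) T(2) by (simp add: pos_divide_le_eq)
    have "(T + t *\<^sub>R ?S) z = (1 + t) *\<^sub>R T z"
      using z(2) by (simp add: blinfun.add_left blinfun.scaleR_left rank_one_apply ip_self algebra_simps)
    then have "(1 + t) * norm (T z) \<le> norm (T + t *\<^sub>R ?S)"
      using norm_blinfun[of "T + t *\<^sub>R ?S" z] z(2) t(1) by simp
    then have "(1 + t) * norm (T z) \<le> 1 + t / 2" using norm_le by simp
    then show ?thesis using t(1) by (simp add: \<rho>_def pos_le_divide_eq mult.commute)
  qed
  have range: "norm (T (w - A w)) \<le> \<rho> * norm (w - A w)" for w
  proof (cases "w - A w = 0")
    case False
    let ?r = "1 / norm (w - A w)"
    have "norm (T (?r *\<^sub>R (w - A w))) \<le> \<rho>"
    proof (rule unit)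
      show "?r *\<^sub>R (w - A w) = ?r *\<^sub>R w - A (?r *\<^sub>R w)"
        by (simp add: blinfun.scaleR_right scaleR_right_diff_distrib)
      show "norm (?r *\<^sub>R (w - A w)) = 1" unfolding norm_scaleR using False by simp
    qed
    then show ?thesis using False by (simp add: blinfun.scaleR_right pos_divide_le_eq)
  qed simp
  have "norm (T z) \<le> \<rho> * norm z" if "\<forall>v\<in>isometric_part T. z \<bullet> v = 0" for z
  proof -
    have "z \<in> closure (range (\<lambda>w. w - A w))"
    proof (rule range_defect_dense)
      show "A x \<bullet> y = x \<bullet> A y" for x y by (metis A inner_commute)
      show "z \<bullet> v = 0" if "A v = v" for v
        using \<open>\<forall>v\<in>isometric_part T. z \<bullet> v = 0\<close> that
        by (simp add: isometric_part_eq_fixed_points[OF A T1])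
    qed
    moreover have "closure (range (\<lambda>w. w - A w)) \<subseteq> {z. norm (T z) \<le> \<rho> * norm z}"
      using range by (intro closure_minimal closed_Collect_le continuous_intros) auto
    ultimately show ?thesis by blast
  qed
  with \<rho> show ?thesis using that by blast
qed

text \<open>
  Were the norming set empty, the isometric part would be zero and the bound off it would hold on
  the whole space, against \<open>norm T = 1\<close>.
\<close>
lemma strongly_subdifferentiable_imp_gap:
  assumes T: "T \<in> bounded_ops smul" "norm T = 1"
    and ssd: "strongly_subdifferentiable (op_smul smul) (bounded_ops smul) T"
  shows "norming_set T \<noteq> {}" "gap_off_isometric_part T"
proof -
  obtain \<rho> where \<rho>: "\<rho> < 1"
    "\<And>z. \<forall>v\<in>isometric_part T. z \<bullet> v = 0 \<Longrightarrow> norm (T z) \<le> \<rho> * norm z"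
    using strongly_subdifferentiable_imp_bound_off_isometric_part[OF T ssd] by blast
  then show "gap_off_isometric_part T" unfolding gap_off_isometric_part_def by blast
  show "norming_set T \<noteq> {}"
  proof
    assume empty: "norming_set T = {}"
    have "v = 0" if "v \<in> isometric_part T" for v
    proof (rule ccontr)
      assume "v \<noteq> 0"
      then have "(1 / norm v) *\<^sub>R v \<in> norming_set T"
        using that by (simp add: norming_set_eq[OF T(2)] isometric_part_def blinfun.scaleR_right)
      then show False using empty by simp
    qed
    then have "norm (T z) \<le> \<rho> * norm z" for z by (intro \<rho>(2)) (metis inner_zero_right)
    then have "norm (T z) \<le> max \<rho> 0 * norm z" for z
      using mult_right_mono[of \<rho> "max \<rho> 0" "norm z"] by (meson max.cobounded1 norm_ge_zero order_trans)
    then have "norm T \<le> max \<rho> 0" by (intro norm_blinfun_bound) auto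
    then show False using \<rho>(1) T(2) by simp
  qed
qed

end

theorem theorem2p7:
  fixes smul :: "'k::real_or_complex \<Rightarrow> 'h::{real_inner, banach} \<Rightarrow> 'h"
    and ip :: "'h \<Rightarrow> 'h \<Rightarrow> 'k"
    and T :: "'h \<Rightarrow>\<^sub>L 'h"
  assumes "hilbert_space smul ip"
    and "infinite_dimensional smul"
    and "T \<in> bounded_ops smul"
    and "norm T = 1"
  shows "(strongly_subdifferentiable (op_smul smul) (bounded_ops smul) T
      \<longleftrightarrow> norming_set T \<noteq> {} \<and>
          (\<forall>x. maximizing_sequence T x \<longrightarrow>
             (\<exists>r. strict_mono (r :: nat \<Rightarrow> nat) \<and>
                  (\<lambda>i. infdist (x (r i)) (norming_set T)) \<longlonglongrightarrow> 0)))
    \<and> (strongly_subdifferentiable (op_smul smul) (bounded_ops smul) T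
      \<longleftrightarrow> attains_norm T \<and>
          restricted_norm (abs_op smul ip T) (orth_complement ip (norming_set T)) < 1)"
proof -
  interpret hilbert_space smul ip by (rule assms(1))
  note T = assms(3,4)
  have T1: "norm T \<le> 1" using T(2) by simp
  have ssd: "strongly_subdifferentiable (op_smul smul) (bounded_ops smul) T
      \<longleftrightarrow> norming_set T \<noteq> {} \<and> gap_off_isometric_part T"
    using gap_imp_strongly_subdifferentiable[OF T] strongly_subdifferentiable_imp_gap[OF T] by blast
  have sequences: "gap_off_isometric_part T \<longleftrightarrow> (\<forall>x. maximizing_sequence T x \<longrightarrow>
      (\<exists>r. strict_mono (r :: nat \<Rightarrow> nat) \<and> (\<lambda>i. infdist (x (r i)) (norming_set T)) \<longlonglongrightarrow> 0))"
    if ne: "norming_set T \<noteq> {}"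
  proof
    assume "gap_off_isometric_part T"
    then show "\<forall>x. maximizing_sequence T x \<longrightarrow>
        (\<exists>r. strict_mono (r :: nat \<Rightarrow> nat) \<and> (\<lambda>i. infdist (x (r i)) (norming_set T)) \<longlonglongrightarrow> 0)"
      using gap_imp_infdist_tendsto_zero[OF T(2) ne] by (blast intro: strict_mono_id[unfolded id_def])
  qed (use infdist_tendsto_zero_imp_gap[OF T(2) ne] in blast)
  have "attains_norm T \<longleftrightarrow> norming_set T \<noteq> {}" by (auto simp: attains_norm_def norming_set_def)
  moreover have "restricted_norm (abs_op smul ip T) (orth_complement ip (norming_set T)) < 1
      \<longleftrightarrow> gap_off_isometric_part T"
    unfolding orth_complement_norming_set[OF T]
    by (rule restricted_norm_less_one_iff_gap[OF T1 norm_abs_op[OF T(1) T1]])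
  ultimately show ?thesis using ssd sequences by blast
qed

end
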